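(* Let $\alpha<0$, $p(\xi)=1$, $q(\xi)=\xi^\alpha$ for $\xi>0$, and let $x$ be a circular solution of the Lagrangian system with $L=\frac12p(\xi)[\dot\xi^2+\xi^2\dot\vartheta^2]+q(\xi)$. Then the Morse index of $x$ is $$m^-(x)=\begin{cases}0&\text{if }\alpha\in(-\infty,-1],\\ 2&\text{if }\alpha\in(-1,0).\end{cases}$$
   Context: Circular solution: a solution $x(t)=(\xi_0,\vartheta_0+\dot\vartheta_0t)$ of the Euler–Lagrange equations of $L$, $(\xi,\vartheta)$ polar coordinates in the punctured plane, with constant $\xi_0>0$ and constant $\dot\vartheta_0>0$, where $\dot\vartheta_0^2=-\alpha\xi_0^{\alpha-2}$; its prime period is $T=2\pi/\dot\vartheta_0$. Morse index: $m^-(x)$ is the maximal dimension of a subspace of $W^{1,2}(\mathbb R/T\mathbb Z,\mathbb R^2)$ on which $I(u,u)=\int_0^T\langle P\dot u,\dot u\rangle+2\langle Qu,\dot u\rangle+\langle Ru,u\rangle\,dt$ is negative definite, where $P=L_{vv}$, $Q=L_{vx}$, $R=L_{xx}$ are evaluated along $x$ (second variation of the action $\int_0^TL\,dt$ on $T$-periodic $H^1$ loops in the punctured plane). *)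

theory Defs
  imports "HOL-Analysis.Analysis" "HOL-Library.Function_Algebras" "HOL-Library.Extended_Nat"
begin

text \<open>
  Loops are total functions \<^typ>\<open>real \<Rightarrow> real ^ 2\<close>, so that spaces of loops are subspaces of a
  function space in the sense of the library constants \<^const>\<open>subspace\<close> and \<^const>\<open>dim\<close>.
\<close>

instantiation "fun" :: (type, real_vector) real_vector
begin

definition scaleR_fun :: "real \<Rightarrow> ('a \<Rightarrow> 'b) \<Rightarrow> 'a \<Rightarrow> 'b"
  where "scaleR_fun c f = (\<lambda>t. c *\<^sub>R f t)"

instance
  by standard (auto simp: scaleR_fun_def fun_eq_iff scaleR_add_right scaleR_add_left)

end

definition partial :: "'n::finite \<Rightarrow> (real ^ 'n \<Rightarrow> real) \<Rightarrow> real ^ 'n \<Rightarrow> real"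
  where "partial i f x = deriv (\<lambda>s. f (x + s *\<^sub>R axis i 1)) 0"

type_synonym lagrangian = "real ^ 2 \<Rightarrow> real ^ 2 \<Rightarrow> real"

definition L_x :: "lagrangian \<Rightarrow> real ^ 2 \<Rightarrow> real ^ 2 \<Rightarrow> real ^ 2"
  where "L_x L x v = (\<chi> i. partial i (\<lambda>y. L y v) x)"

definition L_v :: "lagrangian \<Rightarrow> real ^ 2 \<Rightarrow> real ^ 2 \<Rightarrow> real ^ 2"
  where "L_v L x v = (\<chi> i. partial i (\<lambda>w. L x w) v)"

text \<open>In each matrix of second derivatives the row index \<open>i\<close> belongs to the first-named subscript.\<close>

definition L_vv :: "lagrangian \<Rightarrow> real ^ 2 \<Rightarrow> real ^ 2 \<Rightarrow> real ^ 2 ^ 2"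
  where "L_vv L x v = (\<chi> i j. partial i (\<lambda>w. partial j (\<lambda>w'. L x w') w) v)"

definition L_vx :: "lagrangian \<Rightarrow> real ^ 2 \<Rightarrow> real ^ 2 \<Rightarrow> real ^ 2 ^ 2"
  where "L_vx L x v = (\<chi> i j. partial i (\<lambda>w. partial j (\<lambda>y. L y w) x) v)"

definition L_xx :: "lagrangian \<Rightarrow> real ^ 2 \<Rightarrow> real ^ 2 \<Rightarrow> real ^ 2 ^ 2"
  where "L_xx L x v = (\<chi> i j. partial i (\<lambda>y. partial j (\<lambda>y'. L y' v) y) x)"

text \<open>
  Solutions of the Euler--Lagrange equations with values in the punctured plane, defined for all times.
\<close>

definition euler_lagrange_solution :: "lagrangian \<Rightarrow> (real \<Rightarrow> real ^ 2) \<Rightarrow> bool"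
  where "euler_lagrange_solution L x \<longleftrightarrow>
    (\<forall>t. x t \<noteq> 0) \<and>
    (\<exists>v. (\<forall>t. (x has_vector_derivative v t) (at t)) \<and>
         (\<forall>t. ((\<lambda>s. L_v L (x s) (v s)) has_vector_derivative L_x L (x t) (v t)) (at t)))"

definition polar :: "real \<Rightarrow> real \<Rightarrow> real ^ 2"
  where "polar \<xi> \<theta> = vector [\<xi> * cos \<theta>, \<xi> * sin \<theta>]"

text \<open>
  The Lagrangian \<open>p(\<xi>)[\<xi>'\<^sup>2 + \<xi>\<^sup>2 \<theta>'\<^sup>2] / 2 + q(\<xi>)\<close> in Cartesian coordinates; its values for \<open>x = 0\<close>
  are irrelevant. The lemma below is the change of coordinates.
\<close>

definition radial_lagrangian :: "(real \<Rightarrow> real) \<Rightarrow> (real \<Rightarrow> real) \<Rightarrow> lagrangian"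
  where "radial_lagrangian p q x v = p (norm x) * (norm v)\<^sup>2 / 2 + q (norm x)"

lemma polar_has_vector_derivative:
  assumes "(\<xi> has_real_derivative \<xi>') (at t)" "(\<theta> has_real_derivative \<theta>') (at t)"
  shows "((\<lambda>t. polar (\<xi> t) (\<theta> t)) has_vector_derivative
           vector [\<xi>' * cos (\<theta> t) - \<xi> t * \<theta>' * sin (\<theta> t), \<xi>' * sin (\<theta> t) + \<xi> t * \<theta>' * cos (\<theta> t)])
         (at t)"
proof -
  have 1: "((\<lambda>t. \<xi> t * cos (\<theta> t)) has_real_derivative
      \<xi>' * cos (\<theta> t) - \<xi> t * \<theta>' * sin (\<theta> t)) (at t)"
    by (rule derivative_eq_intros assms refl)+ (simp add: algebra_simps)
  have 2: "((\<lambda>t. \<xi> t * sin (\<theta> t)) has_real_derivative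
      \<xi>' * sin (\<theta> t) + \<xi> t * \<theta>' * cos (\<theta> t)) (at t)"
    by (rule derivative_eq_intros assms refl)+ (simp add: algebra_simps)
  have vec: "vector [a, b] = a *\<^sub>R axis 1 1 + b *\<^sub>R (axis 2 1 :: real ^ 2)" for a b
    by (simp add: vec_eq_iff forall_2 axis_def)
  show ?thesis
    unfolding polar_def vec
    by (intro has_vector_derivative_add
        bounded_linear.has_vector_derivative[OF bounded_linear_scaleR_left]
        1[unfolded has_real_derivative_iff_has_vector_derivative]
        2[unfolded has_real_derivative_iff_has_vector_derivative])
qed

lemma radial_lagrangian_polar:
  assumes "\<xi> t > 0" "(\<xi> has_real_derivative \<xi>') (at t)" "(\<theta> has_real_derivative \<theta>') (at t)"
    and "((\<lambda>t. polar (\<xi> t) (\<theta> t)) has_vector_derivative v) (at t)"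
  shows "radial_lagrangian p q (polar (\<xi> t) (\<theta> t)) v
    = 1 / 2 * p (\<xi> t) * (\<xi>'\<^sup>2 + (\<xi> t)\<^sup>2 * \<theta>'\<^sup>2) + q (\<xi> t)"
proof -
  have v: "v = vector [\<xi>' * cos (\<theta> t) - \<xi> t * \<theta>' * sin (\<theta> t), \<xi>' * sin (\<theta> t) + \<xi> t * \<theta>' * cos (\<theta> t)]"
    using vector_derivative_unique_at[OF assms(4) polar_has_vector_derivative[OF assms(2,3)]] .
  have s: "(sin (\<theta> t))\<^sup>2 = 1 - (cos (\<theta> t))\<^sup>2"
    by (simp add: sin_squared_eq)
  have "(norm (polar (\<xi> t) (\<theta> t)))\<^sup>2 = (\<xi> t)\<^sup>2"
    by (simp add: polar_def norm_vec_def L2_set_def sum_2 power_mult_distrib s algebra_simps)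
  then have n: "norm (polar (\<xi> t) (\<theta> t)) = \<xi> t"
    using assms(1) by (simp add: power2_eq_iff_nonneg)
  have "(norm v)\<^sup>2 = \<xi>'\<^sup>2 + (\<xi> t)\<^sup>2 * \<theta>'\<^sup>2"
    by (simp add: v norm_vec_def L2_set_def sum_2 power2_sum power2_diff power_mult_distrib s algebra_simps)
  then show ?thesis
    by (simp add: radial_lagrangian_def n)
qed

definition circular_solution ::
    "lagrangian \<Rightarrow> real \<Rightarrow> real \<Rightarrow> real \<Rightarrow> (real \<Rightarrow> real ^ 2) \<Rightarrow> bool"
  where "circular_solution L \<xi>\<^sub>0 \<theta>\<^sub>0 \<omega> x \<longleftrightarrow>
    \<xi>\<^sub>0 > 0 \<and> \<omega> > 0 \<and> x = (\<lambda>t. polar \<xi>\<^sub>0 (\<theta>\<^sub>0 + \<omega> * t)) \<and> euler_lagrange_solution L x"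

lemma circular_solution_iff:
  fixes p q :: "real \<Rightarrow> real"
  assumes p: "\<And>\<xi>. \<xi> > 0 \<Longrightarrow> p \<xi> = 1" and q: "\<And>\<xi>. \<xi> > 0 \<Longrightarrow> q \<xi> = \<xi> powr \<alpha>"
  shows "circular_solution (radial_lagrangian p q) \<xi>\<^sub>0 \<theta>\<^sub>0 \<omega> x \<longleftrightarrow>
    \<xi>\<^sub>0 > 0 \<and> \<omega> > 0 \<and> x = (\<lambda>t. polar \<xi>\<^sub>0 (\<theta>\<^sub>0 + \<omega> * t)) \<and> \<omega>\<^sup>2 = - \<alpha> * \<xi>\<^sub>0 powr (\<alpha> - 2)"
proof (cases "\<xi>\<^sub>0 > 0 \<and> \<omega> > 0 \<and> x = (\<lambda>t. polar \<xi>\<^sub>0 (\<theta>\<^sub>0 + \<omega> * t))")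
  case True
  then have pos: "\<xi>\<^sub>0 > 0" and x: "x = (\<lambda>t. polar \<xi>\<^sub>0 (\<theta>\<^sub>0 + \<omega> * t))" by auto
  let ?L = "radial_lagrangian p q"
  have Lv: "L_v ?L y v = v" if "y \<noteq> 0" for y v
  proof -
    have "((\<lambda>s. (norm (v + s *\<^sub>R axis i 1))\<^sup>2 / 2 + c) has_real_derivative v $ i) (at 0)" for i c
      unfolding power2_norm_eq_inner
      by (rule derivative_eq_intros refl | simp add: inner_axis inner_commute[of "axis i 1"] inner_add_left inner_add_right)+
    then show ?thesis
      using that by (simp add: vec_eq_iff L_v_def partial_def radial_lagrangian_def p DERIV_imp_deriv)
  qed
  have Lx: "L_x ?L y v = (\<alpha> * norm y powr (\<alpha> - 2)) *\<^sub>R y" if y: "y \<noteq> 0" for y v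
  proof -
    have "((\<lambda>s. ?L (y + s *\<^sub>R axis i 1) v) has_real_derivative \<alpha> * norm y powr (\<alpha> - 2) * y $ i) (at 0)" for i
    proof -
      let ?n = "\<lambda>s. (y \<bullet> y + 2 * s * y $ i + s\<^sup>2)"
      have n: "(norm (y + s *\<^sub>R axis i 1))\<^sup>2 = ?n s" for s
        unfolding power2_norm_eq_inner
        by (simp add: inner_axis inner_commute[of "axis i 1"] inner_add_left inner_add_right
            power2_eq_square algebra_simps)
      have "isCont ?n 0" by (intro continuous_intros)
      then have "(?n \<longlongrightarrow> y \<bullet> y) (nhds 0)"
        using tendsto_at_iff_tendsto_nhds[of ?n 0] by (simp add: isCont_def)
      then have ev: "\<forall>\<^sub>F s in nhds 0. ?n s > 0"
        using y by (auto dest!: order_tendstoD(1)[of _ _ _ 0])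
      have "((\<lambda>s. (norm v)\<^sup>2 / 2 + ?n s powr (\<alpha> / 2)) has_real_derivative
          \<alpha> / 2 * (y \<bullet> y) powr (\<alpha> / 2 - 1) * (2 * y $ i)) (at 0)"
        using y by (auto intro!: derivative_eq_intros simp: powr_diff)
      also have "\<alpha> / 2 * (y \<bullet> y) powr (\<alpha> / 2 - 1) * (2 * y $ i) = \<alpha> * norm y powr (\<alpha> - 2) * y $ i"
        using y by (simp add: dot_square_norm powr_powr right_diff_distrib flip: powr_numeral)
      finally show ?thesis
      proof (rule DERIV_cong_ev[THEN iffD2, rotated 3])
        show "\<forall>\<^sub>F s in nhds 0. ?L (y + s *\<^sub>R axis i 1) v = (norm v)\<^sup>2 / 2 + ?n s powr (\<alpha> / 2)"
          using ev
        proof eventually_elim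
          case (elim s)
          then have g: "norm (y + s *\<^sub>R axis i 1) > 0"
            unfolding n[symmetric] by simp
          have "?n s powr (\<alpha> / 2) = norm (y + s *\<^sub>R axis i 1) powr \<alpha>"
            unfolding n[symmetric] using g by (simp add: powr_powr flip: powr_numeral)
          then show ?case using g by (simp add: radial_lagrangian_def p q)
        qed
      qed simp_all
    qed
    then show ?thesis
      by (simp add: vec_eq_iff L_x_def partial_def DERIV_imp_deriv)
  qed
  define e f where "e t = polar 1 (\<theta>\<^sub>0 + \<omega> * t)"
    and "f t = (vector [- sin (\<theta>\<^sub>0 + \<omega> * t), cos (\<theta>\<^sub>0 + \<omega> * t)] :: real ^ 2)" for t
  have xe: "x t = \<xi>\<^sub>0 *\<^sub>R e t" for t
    by (simp add: x e_def polar_def vec_eq_iff forall_2)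
  have ne: "norm (e t) = 1" for t
    by (simp add: e_def polar_def norm_vec_def L2_set_def sum_2)
  have nx: "norm (x t) = \<xi>\<^sub>0" for t using pos by (simp add: xe ne)
  then have x0: "x t \<noteq> 0" for t using pos by (metis norm_zero less_irrefl)
  have th: "((\<lambda>t. \<theta>\<^sub>0 + \<omega> * t) has_real_derivative \<omega>) (at t)" for t
    by (auto intro!: derivative_eq_intros)
  have de: "(e has_vector_derivative \<omega> *\<^sub>R f t) (at t)" for t
    unfolding e_def
    by (rule has_vector_derivative_eq_rhs[OF polar_has_vector_derivative[OF DERIV_const th]])
      (simp add: f_def vec_eq_iff forall_2)
  have dx: "(x has_vector_derivative (\<xi>\<^sub>0 * \<omega>) *\<^sub>R f t) (at t)" for t
    using bounded_linear.has_vector_derivative[OF bounded_linear_scaleR_right de, of \<xi>\<^sub>0 t]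
    by (simp add: xe[abs_def])
  have f: "f t = polar 1 (\<theta>\<^sub>0 + pi / 2 + \<omega> * t)" for t
  proof -
    have "\<theta>\<^sub>0 + pi / 2 + \<omega> * t = (\<theta>\<^sub>0 + \<omega> * t) + pi / 2" by simp
    then show ?thesis
      by (simp only: f_def polar_def cos_add sin_add) simp
  qed
  have df: "(f has_vector_derivative - \<omega> *\<^sub>R e t) (at t)" for t
  proof -
    have th': "((\<lambda>t. \<theta>\<^sub>0 + pi / 2 + \<omega> * t) has_real_derivative \<omega>) (at t)"
      by (auto intro!: derivative_eq_intros)
    have *: "\<theta>\<^sub>0 + pi / 2 + \<omega> * t = (\<theta>\<^sub>0 + \<omega> * t) + pi / 2" by simp
    have cs: "cos (\<theta>\<^sub>0 + pi / 2 + \<omega> * t) = - sin (\<theta>\<^sub>0 + \<omega> * t)"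
      "sin (\<theta>\<^sub>0 + pi / 2 + \<omega> * t) = cos (\<theta>\<^sub>0 + \<omega> * t)"
      unfolding * by (simp_all only: cos_add sin_add) simp_all
    show ?thesis
      unfolding f[abs_def]
      by (rule has_vector_derivative_eq_rhs[OF polar_has_vector_derivative[OF DERIV_const th']])
        (simp add: e_def polar_def vec_eq_iff forall_2 cs)
  qed
  have dv: "((\<lambda>s. (\<xi>\<^sub>0 * \<omega>) *\<^sub>R f s) has_vector_derivative (- \<omega>\<^sup>2) *\<^sub>R x t) (at t)" for t
    using bounded_linear.has_vector_derivative[OF bounded_linear_scaleR_right df, of "\<xi>\<^sub>0 * \<omega>" t]
    by (simp add: xe power2_eq_square mult_ac)
  have "euler_lagrange_solution ?L x \<longleftrightarrow>
      (\<forall>t. ((\<lambda>s. (\<xi>\<^sub>0 * \<omega>) *\<^sub>R f s) has_vector_derivative (\<alpha> * \<xi>\<^sub>0 powr (\<alpha> - 2)) *\<^sub>R x t) (at t))"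
    (is "_ \<longleftrightarrow> ?R")
  proof
    assume "euler_lagrange_solution ?L x"
    then obtain v where v: "\<And>t. (x has_vector_derivative v t) (at t)"
      "\<And>t. ((\<lambda>s. L_v ?L (x s) (v s)) has_vector_derivative L_x ?L (x t) (v t)) (at t)"
      by (auto simp: euler_lagrange_solution_def)
    have "v = (\<lambda>t. (\<xi>\<^sub>0 * \<omega>) *\<^sub>R f t)"
      using vector_derivative_unique_at[OF v(1) dx] by blast
    then show ?R using v(2) by (simp add: Lv Lx x0 nx)
  next
    assume ?R
    then show "euler_lagrange_solution ?L x"
      unfolding euler_lagrange_solution_def
      by (intro conjI allI x0 exI[of _ "\<lambda>t. (\<xi>\<^sub>0 * \<omega>) *\<^sub>R f t"] dx) (simp add: Lv Lx x0 nx)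
  qed
  also have "\<dots> \<longleftrightarrow> (- \<omega>\<^sup>2 = \<alpha> * \<xi>\<^sub>0 powr (\<alpha> - 2))"
    using dv vector_derivative_unique_at[OF dv] x0 by (metis scaleR_right_imp_eq)
  finally show ?thesis
    using True by (auto simp: circular_solution_def)
qed (auto simp: circular_solution_def)

text \<open>Elements of \<open>L\<^sup>2([0,T], \<real>\<^sup>2)\<close>, as Borel functions rather than classes modulo null sets.\<close>

definition square_integrable :: "real \<Rightarrow> (real \<Rightarrow> real ^ 2) \<Rightarrow> bool"
  where "square_integrable T g \<longleftrightarrow>
    set_borel_measurable lborel {0..T} g \<and> set_integrable lborel {0..T} (\<lambda>t. (norm (g t))\<^sup>2)"

definition periodic_test_function :: "real \<Rightarrow> (real \<Rightarrow> real) \<Rightarrow> bool"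
  where "periodic_test_function T \<phi> \<longleftrightarrow>
    (\<forall>k. (deriv ^^ k) \<phi> differentiable_on UNIV) \<and> (\<forall>t. \<phi> (t + T) = \<phi> t)"

definition has_weak_derivative ::
    "real \<Rightarrow> (real \<Rightarrow> real ^ 2) \<Rightarrow> (real \<Rightarrow> real ^ 2) \<Rightarrow> bool"
  where "has_weak_derivative T u g \<longleftrightarrow>
    (\<forall>\<phi>. periodic_test_function T \<phi> \<longrightarrow>
      (LINT t:{0..T}|lborel. deriv \<phi> t *\<^sub>R u t) = - (LINT t:{0..T}|lborel. \<phi> t *\<^sub>R g t))"

text \<open>
  \<open>W\<^sup>1\<^sup>,\<^sup>2(\<real>/T\<int>, \<real>\<^sup>2)\<close>: every class modulo null sets contains exactly one continuous function
  (Sobolev embedding in dimension one), which represents it here.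
\<close>

definition W12_loops :: "real \<Rightarrow> (real \<Rightarrow> real ^ 2) set"
  where "W12_loops T = {u. continuous_on UNIV u \<and> (\<forall>t. u (t + T) = u t) \<and>
    (\<exists>g. square_integrable T g \<and> has_weak_derivative T u g)}"

text \<open>The weak derivative is determined up to a null set, so the choice does not affect integrals.\<close>

definition weak_deriv :: "real \<Rightarrow> (real \<Rightarrow> real ^ 2) \<Rightarrow> real \<Rightarrow> real ^ 2"
  where "weak_deriv T u = (SOME g. square_integrable T g \<and> has_weak_derivative T u g)"

text \<open>The quadratic form \<open>I(u,u)\<close> of the second variation of the action at the smooth loop \<open>x\<close>.\<close>

definition second_variation ::
    "lagrangian \<Rightarrow> real \<Rightarrow> (real \<Rightarrow> real ^ 2) \<Rightarrow> (real \<Rightarrow> real ^ 2) \<Rightarrow> real"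
  where "second_variation L T x u =
    (let P = (\<lambda>t. L_vv L (x t) (vector_derivative x (at t)));
         Q = (\<lambda>t. L_vx L (x t) (vector_derivative x (at t)));
         R = (\<lambda>t. L_xx L (x t) (vector_derivative x (at t)));
         u' = weak_deriv T u
     in LINT t:{0..T}|lborel. (P t *v u' t) \<bullet> u' t + 2 * ((Q t *v u t) \<bullet> u' t) + (R t *v u t) \<bullet> u t)"

text \<open>
  Since \<^const>\<open>dim\<close> is meaningless on infinite-dimensional subspaces, only those spanned by finite sets
  are admitted; an infinite-dimensional negative definite subspace has finite-dimensional ones of
  every dimension, and the supremum is then \<open>\<infinity>\<close>. The set below contains \<open>0\<close> (take \<open>S = {0}\<close>), so a finite
  supremum is a maximum.
\<close>

definition morse_index :: "lagrangian \<Rightarrow> real \<Rightarrow> (real \<Rightarrow> real ^ 2) \<Rightarrow> enat"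
  where "morse_index L T x = Sup {enat (dim S) | S.
    subspace S \<and> S \<subseteq> W12_loops T \<and> (\<exists>B. finite B \<and> span B = S) \<and>
    (\<forall>u\<in>S. u \<noteq> 0 \<longrightarrow> second_variation L T x u < 0)}"

end

theory Submission
  imports Defs
begin

text \<open>
  In the frame rotating with the solution write \<open>a\<close>, \<open>b\<close> for the radial and tangential components of a
  loop \<open>u\<close> and \<open>a'\<close>, \<open>b'\<close> for their weak derivatives. As \<open>a b\<close> has a derivative of mean zero, the second
  variation is the integral of \<open>(b' + 2 \<omega> a)\<^sup>2 + a'\<^sup>2 - (2 + \<alpha>) \<omega>\<^sup>2 a\<^sup>2\<close>. The first square absorbs
  the mean of \<open>a\<close>, since \<open>b'\<close> has mean zero; Wirtinger's inequality for \<open>a\<close> minus its mean then makes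
  the integral nonnegative if \<open>2 + \<alpha> \<le> 1\<close>; if \<open>2 + \<alpha> \<le> 4\<close>, it does so once the two Fourier coefficients
  of \<open>a\<close> of frequency \<open>\<omega>\<close> vanish, which bounds the index by 2. For \<open>\<alpha> > -1\<close> the loops with \<open>b' = - 2 \<omega> a\<close> and
  \<open>a\<close> of pure frequency \<open>\<omega>\<close> form a plane on which the form is negative.

  All Fourier analysis uses the Hartley basis \<open>cos (k \<omega> t) + sin (k \<omega> t)\<close>, \<open>k\<close> an integer: it is a real
  orthogonal basis indexed by one parameter, and differentiation maps the element of index \<open>k\<close> to
  \<open>k \<omega>\<close> times the one of index \<open>- k\<close>.
\<close>

section \<open>Square integrable functions\<close>

text \<open>Functions rather than classes, so that pointwise identities remain available.
  Measurability is a separate conjunct because that of the square does not imply it.\<close>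

definition L2 :: "'a measure \<Rightarrow> ('a \<Rightarrow> real) \<Rightarrow> bool"
  where "L2 M f \<longleftrightarrow> f \<in> borel_measurable M \<and> integrable M (\<lambda>t. (f t)\<^sup>2)"

lemma L2_measurable [measurable_dest]: "L2 M f \<Longrightarrow> f \<in> borel_measurable M"
  by (simp add: L2_def)

lemma L2_square: "L2 M f \<Longrightarrow> integrable M (\<lambda>t. (f t)\<^sup>2)"
  by (simp add: L2_def)

lemma L2_mult:
  assumes "L2 M f" "L2 M g"
  shows "integrable M (\<lambda>t. f t * g t)"
proof (rule Bochner_Integration.integrable_bound)
  show "integrable M (\<lambda>t. (f t)\<^sup>2 + (g t)\<^sup>2)"
    using assms by (simp add: L2_def)
  show "(\<lambda>t. f t * g t) \<in> borel_measurable M"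
    using assms by measurable
  have "\<bar>a * b\<bar> \<le> a\<^sup>2 + b\<^sup>2" for a b :: real
  proof -
    have "2 * (\<bar>a\<bar> * \<bar>b\<bar>) \<le> a\<^sup>2 + b\<^sup>2"
      using sum_squares_bound[of "\<bar>a\<bar>" "\<bar>b\<bar>"] by (simp add: mult.assoc)
    moreover have "0 \<le> \<bar>a\<bar> * \<bar>b\<bar>" by simp
    ultimately show ?thesis unfolding abs_mult by linarith
  qed
  then show "AE t in M. norm (f t * g t) \<le> norm ((f t)\<^sup>2 + (g t)\<^sup>2)"
    by simp
qed

lemma L2_cmult: "L2 M f \<Longrightarrow> L2 M (\<lambda>t. c * f t)"
  by (auto simp: L2_def power_mult_distrib)

lemma L2_add:
  assumes "L2 M f" "L2 M g"
  shows "L2 M (\<lambda>t. f t + g t)"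
proof -
  have "integrable M (\<lambda>t. (f t)\<^sup>2 + (g t)\<^sup>2 + 2 * (f t * g t))"
    using assms L2_mult[OF assms] by (simp add: L2_def)
  moreover have "(\<lambda>t. f t + g t) \<in> borel_measurable M"
    using assms by measurable
  ultimately show ?thesis
    by (simp add: L2_def power2_sum mult.assoc)
qed

lemma L2_diff:
  assumes "L2 M f" "L2 M g"
  shows "L2 M (\<lambda>t. f t - g t)"
  using L2_add[OF assms(1) L2_cmult[OF assms(2), of "-1"]] by simp

lemma L2_sum: "(\<And>i. i \<in> I \<Longrightarrow> L2 M (f i)) \<Longrightarrow> L2 M (\<lambda>t. \<Sum>i\<in>I. f i t)"
proof (induction I rule: infinite_finite_induct)
  case (insert i I)
  then show ?case by (simp add: L2_add)
qed (simp_all add: L2_def)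

lemma (in finite_measure) L2_const: "L2 M (\<lambda>t. c)"
  by (simp add: L2_def)

lemma (in finite_measure) L2_integrable: "L2 M f \<Longrightarrow> integrable M f"
  using L2_mult[OF _ L2_const[of 1]] by simp

lemma L2_bounded_mult:
  assumes f: "f \<in> borel_measurable M" "\<And>t. \<bar>f t\<bar> \<le> C" and g: "L2 M g"
  shows "L2 M (\<lambda>t. f t * g t)"
  unfolding L2_def
proof
  show "(\<lambda>t. f t * g t) \<in> borel_measurable M"
    using f(1) g by measurable
  show "integrable M (\<lambda>t. (f t * g t)\<^sup>2)"
  proof (rule Bochner_Integration.integrable_bound)
    show "integrable M (\<lambda>t. C\<^sup>2 * (g t)\<^sup>2)"
      using g by (simp add: L2_def)
    have "(f t)\<^sup>2 \<le> C\<^sup>2" for t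
      using f(2) by (metis abs_ge_zero power_mono power2_abs)
    then show "AE t in M. norm ((f t * g t)\<^sup>2) \<le> norm (C\<^sup>2 * (g t)\<^sup>2)"
      by (simp add: power_mult_distrib mult_right_mono)
    show "(\<lambda>t. (f t * g t)\<^sup>2) \<in> borel_measurable M"
      using f(1) g by measurable
  qed
qed

text \<open>Components in the rotating frame are sums of such products; the phase \<open>c\<close>
  covers sines as well.\<close>

lemma L2_trig_mult:
  fixes g :: "real \<Rightarrow> real"
  assumes "L2 (restrict_space lborel A) g"
  shows "L2 (restrict_space lborel A) (\<lambda>t. cos (\<mu> * t + c) * g t)"
  by (rule L2_bounded_mult[OF _ _ assms, where C = 1]) (auto intro!: measurable_restrict_space1)

section \<open>Lebesgue measure on one period\<close>

abbreviation lborel_upto :: "real \<Rightarrow> real measure"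
  where "lborel_upto T \<equiv> restrict_space lborel {0..T}"

lemma finite_measure_lborel_upto: "finite_measure (lborel_upto T)"
proof (rule finite_measureI)
  show "emeasure (lborel_upto T) (space (lborel_upto T)) \<noteq> \<infinity>"
    by (simp add: emeasure_restrict_space space_restrict_space emeasure_lborel_Icc_eq)
qed

lemma set_integral_lborel_upto:
  fixes f :: "real \<Rightarrow> 'b::{banach, second_countable_topology}"
  shows "(LINT t:{0..T}|lborel. f t) = integral\<^sup>L (lborel_upto T) f"
  by (simp add: set_lebesgue_integral_def integral_restrict_space)

lemma set_integrable_lborel_upto:
  fixes f :: "real \<Rightarrow> 'b::{banach, second_countable_topology}"
  shows "set_integrable lborel {0..T} f \<longleftrightarrow> integrable (lborel_upto T) f"
  by (simp add: set_integrable_def integrable_restrict_space)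

lemma integrable_continuous_lborel_upto:
  fixes f :: "real \<Rightarrow> 'b::{banach, second_countable_topology}"
  assumes "continuous_on UNIV f"
  shows "integrable (lborel_upto T) f"
  unfolding set_integrable_lborel_upto[symmetric] set_integrable_def
  by (rule borel_integrable_compact) (use assms continuous_on_subset in auto)

lemma L2_continuous:
  assumes "continuous_on UNIV f"
  shows "L2 (lborel_upto T) f"
proof -
  have "continuous_on UNIV (\<lambda>t. (f t)\<^sup>2)"
    using assms by (intro continuous_intros)
  then show ?thesis
    using assms integrable_continuous_lborel_upto by (auto simp: L2_def)
qed

lemma integral_lborel_upto_FTC:
  fixes f F :: "real \<Rightarrow> 'b::euclidean_space"
  assumes "0 \<le> T" "\<And>t. (F has_vector_derivative f t) (at t)" "continuous_on UNIV f"
  shows "integral\<^sup>L (lborel_upto T) f = F T - F 0"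
proof -
  have "(LINT t:{0..T}|lborel. f t) = F T - F 0"
    unfolding set_lebesgue_integral_def
    by (rule integral_FTC_Icc)
      (use assms in \<open>auto intro: has_vector_derivative_at_within continuous_on_subset\<close>)
  then show ?thesis by (simp add: set_integral_lborel_upto)
qed

text \<open>Serves to discard the end points 0 and \<open>T\<close>, which are the same point of the
  circle.\<close>

lemma AE_lborel_upto_neq: "AE t in lborel_upto T. t \<noteq> c"
  using AE_lborel_singleton[of c] by (auto simp: AE_restrict_space_iff elim: eventually_mono)

section \<open>The Hartley basis\<close>

locale frequency =
  fixes \<omega> :: real
  assumes frequency_pos: "\<omega> > 0"
begin

definition T :: real where "T = 2 * pi / \<omega>"

lemma T_pos: "T > 0"
  using frequency_pos by (simp add: T_def)

lemma frequency_times_T: "\<omega> * T = 2 * pi"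
  using frequency_pos by (simp add: T_def)

abbreviation M :: "real measure" where "M \<equiv> lborel_upto T"

sublocale finite_measure M
  by (rule finite_measure_lborel_upto)

lemma measure_M [simp]: "measure M {0..T} = T"
  using T_pos by (simp add: measure_restrict_space)

lemma integral_const: "(\<integral>t. c \<partial>M) = c * T" for c :: real
proof -
  have "measure M (space M) = T"
    using T_pos by (simp add: space_restrict_space)
  then show ?thesis
    by (simp only: lebesgue_integral_const) simp
qed

lemma cos_periodic: "cos (of_int k * \<omega> * (t + T) + c) = cos (of_int k * \<omega> * t + c)"
proof -
  have "of_int k * \<omega> * (t + T) + c = (of_int k * \<omega> * t + c) + 2 * pi * of_int k"
    using frequency_times_T by (simp add: algebra_simps)
  then show ?thesis
    by (simp only: cos_add sin_int_2pin cos_int_2pin) simp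
qed

lemma sin_eq_cos_shift: "sin x = cos (x - pi / 2)" for x :: real
  by (simp add: cos_diff)

lemma integral_cos: "(\<integral>t. cos (of_int k * \<omega> * t + c) \<partial>M) = (if k = 0 then T * cos c else 0)"
proof (cases "k = 0")
  case True
  have "(\<integral>t. cos (of_int k * \<omega> * t + c) \<partial>M) = (\<integral>t. cos c \<partial>M)"
    unfolding True by simp
  then show ?thesis unfolding True integral_const by simp
next
  case False
  let ?F = "\<lambda>t. sin (of_int k * \<omega> * t + c) / (of_int k * \<omega>)"
  have "(\<integral>t. cos (of_int k * \<omega> * t + c) \<partial>M) = ?F T - ?F 0"
  proof (rule integral_lborel_upto_FTC)
    have "(?F has_real_derivative cos (of_int k * \<omega> * t + c)) (at t)" for t
      using False frequency_pos by (auto intro!: derivative_eq_intros)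
    then show "(?F has_vector_derivative cos (of_int k * \<omega> * t + c)) (at t)" for t
      by (simp add: has_real_derivative_iff_has_vector_derivative)
  qed (use T_pos in \<open>auto intro!: continuous_intros\<close>)
  also have "?F T = ?F 0"
    using cos_periodic[of k 0 "c - pi / 2"] unfolding sin_eq_cos_shift by (simp add: add_diff_eq)
  finally show ?thesis using False by simp
qed

definition hart :: "int \<Rightarrow> real \<Rightarrow> real"
  where "hart k t = cos (of_int k * \<omega> * t) + sin (of_int k * \<omega> * t)"

text \<open>As a single cosine with a phase, \<open>hart k\<close> inherits integrals and iterated
  derivatives from the cosine formulas.\<close>

lemma hart_eq_cos: "hart k t = sqrt 2 * cos (of_int k * \<omega> * t - pi / 4)"
proof -
  have "sqrt 2 * cos (x - pi / 4) = (sqrt 2 * sqrt 2) * (cos x + sin x) / 2" for x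
    unfolding cos_diff cos_45 sin_45 by (simp only: distrib_left times_divide_eq_right mult_ac add_divide_distrib)
  from this[of "of_int k * \<omega> * t"] show ?thesis
    unfolding hart_def by simp
qed

lemma hart_0 [simp]: "hart 0 t = 1"
  by (simp add: hart_def)

lemma continuous_hart [continuous_intros]: "continuous_on A (hart k)"
  unfolding hart_def[abs_def] by (intro continuous_intros)

lemma hart_has_derivative: "(hart k has_real_derivative of_int k * \<omega> * hart (- k) t) (at t)"
  unfolding hart_def[abs_def] by (auto intro!: derivative_eq_intros simp: algebra_simps)

text \<open>The first two terms add up to twice the cosine of the difference of the angles, the last
  two to twice the sine of their sum. The formula yields orthogonality and the closure of the span
  under products.\<close>

lemma hart_mult: "2 * (hart k t * hart l t) = hart (k - l) t + hart (l - k) t + hart (k + l) t - hart (- k - l) t"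
  by (simp add: hart_def cos_add cos_diff sin_add sin_diff algebra_simps)

lemma L2_hart: "L2 M (hart k)"
  by (intro L2_continuous continuous_intros)

lemma integral_hart: "(\<integral>t. hart k t \<partial>M) = (if k = 0 then T else 0)"
proof -
  have "hart k = (\<lambda>t. sqrt 2 * cos (of_int k * \<omega> * t + - (pi / 4)))"
    by (simp add: hart_eq_cos fun_eq_iff)
  then have "(\<integral>t. hart k t \<partial>M) = sqrt 2 * (if k = 0 then T * cos (- (pi / 4)) else 0)"
    by (simp only: integral_mult_right_zero integral_cos)
  then show ?thesis
    by (simp add: cos_45)
qed

lemma hart_orthogonal: "(\<integral>t. hart k t * hart l t \<partial>M) = (if k = l then T else 0)"
proof -
  have i: "integrable M (hart n)" for n
    by (rule L2_integrable[OF L2_hart])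
  have "2 * (\<integral>t. hart k t * hart l t \<partial>M) = (\<integral>t. hart (k - l) t + hart (l - k) t + hart (k + l) t - hart (- k - l) t \<partial>M)"
    by (simp only: hart_mult[symmetric] integral_mult_right_zero)
  \<comment> \<open>The terms of index \<open>k + l\<close> and \<open>- k - l\<close> have equal
    integrals, so they cancel even where \<open>k + l = 0\<close>.\<close>
  also have "\<dots> = (if k = l then 2 * T else 0)"
    using i by (auto simp: integral_hart)
  finally show ?thesis by auto
qed

text \<open>Not normalized: the basis elements have squared norm \<open>T\<close>, so the Fourier
  coefficient is \<open>coeff h k / T\<close>.\<close>

definition coeff :: "(real \<Rightarrow> real) \<Rightarrow> int \<Rightarrow> real"
  where "coeff h k = (\<integral>t. hart k t * h t \<partial>M)"

lemma coeff_integrable: "L2 M h \<Longrightarrow> integrable M (\<lambda>t. hart k t * h t)"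
  by (rule L2_mult[OF L2_hart])

lemma coeff_add: "L2 M f \<Longrightarrow> L2 M g \<Longrightarrow> coeff (\<lambda>t. f t + g t) k = coeff f k + coeff g k"
  by (simp add: coeff_def distrib_left coeff_integrable)

lemma coeff_diff: "L2 M f \<Longrightarrow> L2 M g \<Longrightarrow> coeff (\<lambda>t. f t - g t) k = coeff f k - coeff g k"
  by (simp add: coeff_def right_diff_distrib coeff_integrable)

lemma coeff_cmult: "coeff (\<lambda>t. c * f t) k = c * coeff f k"
  by (simp add: coeff_def mult.left_commute)

lemma coeff_const: "coeff (\<lambda>t. c) k = (if k = 0 then c * T else 0)"
  by (simp add: coeff_def integral_hart)

text \<open>Orthogonality and completing the square in each \<open>d k\<close>. Arbitrary
  \<open>d\<close> serves two purposes: \<open>d k = coeff h k / T\<close> gives Bessel's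
  inequality, an approximating polynomial gives the upper half of Parseval's identity.\<close>

lemma integral_square_diff_hart_sum:
  assumes K: "finite K" and h: "L2 M h"
  shows "(\<integral>t. (h t - (\<Sum>k\<in>K. d k * hart k t))\<^sup>2 \<partial>M)
    = (\<integral>t. (h t)\<^sup>2 \<partial>M) - (\<Sum>k\<in>K. (coeff h k)\<^sup>2) / T + (\<Sum>k\<in>K. (T * d k - coeff h k)\<^sup>2) / T"
proof -
  let ?p = "\<lambda>t. \<Sum>k\<in>K. d k * hart k t"
  have p: "L2 M ?p" by (intro L2_sum L2_cmult L2_hart)
  have hp: "(\<integral>t. g t * ?p t \<partial>M) = (\<Sum>k\<in>K. d k * coeff g k)" if "L2 M g" for g
  proof -
    have "(\<integral>t. g t * ?p t \<partial>M) = (\<integral>t. (\<Sum>k\<in>K. d k * (hart k t * g t)) \<partial>M)"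
      by (simp add: sum_distrib_left mult_ac)
    also have "\<dots> = (\<Sum>k\<in>K. d k * coeff g k)"
      by (subst Bochner_Integration.integral_sum) (auto simp: coeff_def intro!: coeff_integrable that)
    finally show ?thesis .
  qed
  have cp: "coeff ?p k = T * d k" if "k \<in> K" for k
  proof -
    have "coeff ?p k = (\<integral>t. hart k t * ?p t \<partial>M)" by (simp add: coeff_def)
    also have "\<dots> = (\<Sum>l\<in>K. d l * (if l = k then T else 0))"
      by (subst hp[OF L2_hart]) (simp add: coeff_def hart_orthogonal)
    also have "\<dots> = T * d k"
      using K that by (simp add: if_distrib[of "\<lambda>x. _ * x"] cong: if_cong)
    finally show ?thesis .
  qed
  have square_diff: "(a - b)\<^sup>2 = a\<^sup>2 + b * b - 2 * (a * b)" for a b :: real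
    by (simp add: power2_eq_square left_diff_distrib right_diff_distrib mult.commute)
  have "(\<integral>t. (h t - ?p t)\<^sup>2 \<partial>M) = (\<integral>t. (h t)\<^sup>2 + ?p t * ?p t - 2 * (h t * ?p t) \<partial>M)"
    by (intro Bochner_Integration.integral_cong refl) (rule square_diff)
  also have "\<dots> = (\<integral>t. (h t)\<^sup>2 \<partial>M) + (\<integral>t. ?p t * ?p t \<partial>M) - 2 * (\<integral>t. h t * ?p t \<partial>M)"
    using L2_square[OF h] L2_mult[OF h p] L2_mult[OF p p] by simp
  also have "\<dots> = (\<integral>t. (h t)\<^sup>2 \<partial>M) + (\<Sum>k\<in>K. T * (d k)\<^sup>2 - 2 * d k * coeff h k)"
    unfolding hp[OF h] hp[OF p]
    by (simp add: sum_subtractf cp sum_distrib_left power2_eq_square mult_ac)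
  also have "(\<Sum>k\<in>K. T * (d k)\<^sup>2 - 2 * d k * coeff h k)
      = (\<Sum>k\<in>K. (T * d k - coeff h k)\<^sup>2 / T - (coeff h k)\<^sup>2 / T)"
    using T_pos by (intro sum.cong refl) (simp add: field_simps power2_eq_square)
  finally show ?thesis
    by (simp add: sum_subtractf sum_divide_distrib)
qed

lemma bessel_inequality:
  assumes "finite K" "L2 M h"
  shows "(\<Sum>k\<in>K. (coeff h k)\<^sup>2) / T \<le> (\<integral>t. (h t)\<^sup>2 \<partial>M)"
proof -
  have "0 \<le> (\<integral>t. (h t - (\<Sum>k\<in>K. (coeff h k / T) * hart k t))\<^sup>2 \<partial>M)"
    by simp
  also have "\<dots> = (\<integral>t. (h t)\<^sup>2 \<partial>M) - (\<Sum>k\<in>K. (coeff h k)\<^sup>2) / T"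
    using T_pos by (subst integral_square_diff_hart_sum[OF assms]) simp
  finally show ?thesis by simp
qed

end

section \<open>Density of trigonometric polynomials\<close>

lemma span_times_right:
  fixes h :: "'a \<Rightarrow> real"
  assumes "\<And>b. b \<in> B \<Longrightarrow> (\<lambda>t. h t * b t) \<in> span B" "g \<in> span B"
  shows "(\<lambda>t. h t * g t) \<in> span B"
  using assms(2)
proof (rule span_induct)
  have eq: "(\<lambda>t. h t * (x + y) t) = (\<lambda>t. h t * x t) + (\<lambda>t. h t * y t)"
    "(\<lambda>t. h t * (c *\<^sub>R x) t) = c *\<^sub>R (\<lambda>t. h t * x t)" "(\<lambda>t. h t * 0 t) = 0" for x y c
    by (auto simp: fun_eq_iff scaleR_fun_def distrib_left)
  show "subspace {g. (\<lambda>t. h t * g t) \<in> span B}"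
    unfolding subspace_def
    by (intro conjI ballI allI impI; simp only: mem_Collect_eq eq; intro span_add span_scale span_zero)
qed (rule assms(1))

context frequency
begin

lemma hart_mult_mem_span: "(\<lambda>t. hart k t * hart l t) \<in> span (range hart)"
proof -
  have "(\<lambda>t. hart k t * hart l t)
      = (1 / 2) *\<^sub>R (hart (k - l) + hart (l - k) + hart (k + l) - hart (- k - l))"
    using hart_mult[of k _ l] by (auto simp: fun_eq_iff scaleR_fun_def field_simps)
  then show ?thesis
    by (simp only:) (intro span_scale span_add span_diff; rule span_base; simp)
qed

text \<open>Bilinearity reduces the product to products of two basis elements, one factor at a
  time.\<close>

lemma span_hart_mult:
  assumes "f \<in> span (range hart)" "g \<in> span (range hart)"
  shows "(\<lambda>t. f t * g t) \<in> span (range hart)"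
proof (rule span_times_right[OF _ assms(2)])
  fix b assume "b \<in> range hart"
  then obtain l where b: "b = hart l" by auto
  have "(\<lambda>t. hart l t * f t) \<in> span (range hart)"
    by (rule span_times_right[OF _ assms(1)]) (auto intro: hart_mult_mem_span)
  then show "(\<lambda>t. f t * b t) \<in> span (range hart)"
    by (simp add: b mult.commute)
qed

text \<open>Connects Stone-Weierstrass on the circle with the Hartley basis: on the circle,
  polynomials in the coordinates are trigonometric polynomials.\<close>

lemma real_polynomial_cis_mem_span:
  fixes g :: "complex \<Rightarrow> real"
  assumes "real_polynomial_function g"
  shows "(\<lambda>t. g (cis (\<omega> * t))) \<in> span (range hart)"
  using assms
proof induction
  case (linear f)
  interpret bounded_linear f by (rule linear)
  have "z = Re z *\<^sub>R 1 + Im z *\<^sub>R \<i>" for z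
    by (simp add: complex_eq_iff)
  then have "f (cis (\<omega> * t)) = cos (\<omega> * t) * f 1 + sin (\<omega> * t) * f \<i>" for t
    by (metis add scaleR cis.simps real_scaleR_def)
  \<comment> \<open>Cosine and sine are half the sum and half the difference of
    \<open>hart 1\<close> and \<open>hart (- 1)\<close>.\<close>
  then have "(\<lambda>t. f (cis (\<omega> * t)))
      = ((f 1 + f \<i>) / 2) *\<^sub>R hart 1 + ((f 1 - f \<i>) / 2) *\<^sub>R hart (- 1)"
    by (auto simp: fun_eq_iff scaleR_fun_def hart_def field_simps)
  then show ?case
    by (simp only:) (intro span_scale span_add; rule span_base; simp)
next
  case (const c)
  have "(\<lambda>t. c) = c *\<^sub>R hart 0"
    by (auto simp: fun_eq_iff scaleR_fun_def)
  then show ?case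
    by (simp only:) (intro span_scale span_base rangeI)
next
  case (add f g)
  then show ?case
    using span_add[OF add.IH] by (simp add: plus_fun_def)
next
  case (mult f g)
  then show ?case by (intro span_hart_mult)
qed

lemma span_hart_explicit:
  assumes "p \<in> span (range hart)"
  obtains K d where "finite K" "\<And>t. p t = (\<Sum>k\<in>K. d k * hart k t)"
proof -
  obtain S r where S: "finite S" "S \<subseteq> range hart" and p: "p = (\<Sum>a\<in>S. r a *\<^sub>R a)"
    using assms unfolding span_explicit by auto
  \<comment> \<open>Choosing one index for each element of \<open>S\<close> makes the reindexing
    injective.\<close>
  obtain K where K: "inj_on hart K" "S = hart ` K"
    using S(2) by (meson subset_image_inj)
  have [simp]: "finite K" using K S by (simp add: finite_image_iff)
  have sum_fun: "(\<Sum>k\<in>I. f k) t = (\<Sum>k\<in>I. f k t)" for f :: "int \<Rightarrow> real \<Rightarrow> real" and I t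
    by (induction I rule: infinite_finite_induct) auto
  have "p t = (\<Sum>k\<in>K. r (hart k) * hart k t)" for t
    by (simp add: p K sum.reindex sum_fun scaleR_fun_def)
  then show thesis using that[of K "\<lambda>k. r (hart k)"] by simp
qed

lemma periodic_int:
  assumes "\<And>t. h (t + T) = h t"
  shows "h (t + of_int n * T) = h t"
proof (induction n rule: int_induct[where k = 0])
  case (step1 i)
  then show ?case using assms[of "t + of_int i * T"] by (simp add: algebra_simps)
next
  case (step2 i)
  then show ?case using assms[of "t + of_int (i - 1) * T"] by (simp add: algebra_simps)
qed simp

lemma periodic_cis_cong:
  assumes "\<And>t. h (t + T) = h t" "cis x = cis y"
  shows "h (x / \<omega>) = h (y / \<omega>)"
proof -
  have "sin x = sin y \<and> cos x = cos y"
    using assms(2) by (simp add: complex_eq_iff)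
  then obtain n :: int where "x = y + 2 * pi * of_int n"
    using sin_cos_eq_iff by blast
  then have "x / \<omega> = y / \<omega> + of_int n * T"
    using frequency_pos by (simp add: T_def field_simps)
  then show ?thesis using periodic_int[of h, OF assms(1)] by simp
qed

text \<open>A periodic function descends to the circle through any choice of argument, and the
  circle is compact, as Stone-Weierstrass requires.\<close>

lemma periodic_on_circle:
  fixes h :: "real \<Rightarrow> real"
  assumes cont: "continuous_on UNIV h" and per: "\<And>t. h (t + T) = h t"
  obtains U where "continuous_on (sphere 0 1) U" "\<And>t. U (cis (\<omega> * t)) = h t"
proof
  let ?U = "\<lambda>z. h (Arg z / \<omega>)"
  have isc: "isCont h t" for t
    using cont by (simp add: continuous_on_eq_continuous_at)
  show "?U (cis (\<omega> * t)) = h t" for t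
    using periodic_cis_cong[of h "Arg (cis (\<omega> * t))" "\<omega> * t", OF per] frequency_pos
    by (simp add: cis_Arg sgn_eq)
  show "continuous_on (sphere 0 1) ?U"
    unfolding continuous_on_eq_continuous_within
  proof
    fix z :: complex assume z: "z \<in> sphere 0 1"
    show "continuous (at z within sphere 0 1) ?U"
    proof (cases "z \<in> \<real>\<^sub>\<le>\<^sub>0")
      case False
      have "isCont ?U z"
        using False by (intro continuous_intros isCont_o2[OF _ isc] continuous_at_Arg) (use frequency_pos in auto)
      then show ?thesis by (rule continuous_at_imp_continuous_within)
    next
      case True
      \<comment> \<open>\<open>Arg\<close> jumps on the negative real axis, so near this point
        \<open>Arg2pi\<close> replaces it, whose jump lies on the positive axis; by periodicity both
        choices define the same function on the circle.\<close>
      with z have nz: "z \<notin> \<real>\<^sub>\<ge>\<^sub>0"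
        by (auto simp: complex_nonpos_Reals_iff complex_nonneg_Reals_iff cmod_def)
      have "isCont (\<lambda>z. h (Arg2pi z / \<omega>)) z"
        using nz by (intro continuous_intros isCont_o2[OF _ isc] continuous_at_Arg2pi) (use frequency_pos in auto)
      then have c: "continuous (at z within sphere 0 1) (\<lambda>z. h (Arg2pi z / \<omega>))"
        by (rule continuous_at_imp_continuous_within)
      show ?thesis
      proof (rule continuous_transform_within[OF c, of 1])
        fix w :: complex assume w: "w \<in> sphere 0 1"
        then have "w \<noteq> 0" by auto
        with w have "cis (Arg2pi w) = w" "cis (Arg w) = w"
          using complex_norm_eq_1_exp[of w] by (auto simp: cis_conv_exp[symmetric] cis_Arg sgn_eq)
        then show "h (Arg2pi w / \<omega>) = ?U w"
          by (intro periodic_cis_cong per) simp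
      qed (use z in auto)
    qed
  qed
qed

lemma hart_dense:
  fixes h :: "real \<Rightarrow> real"
  assumes "continuous_on UNIV h" "\<And>t. h (t + T) = h t" "\<epsilon> > 0"
  obtains K d where "finite K" "\<And>t. \<bar>h t - (\<Sum>k\<in>K. d k * hart k t)\<bar> < \<epsilon>"
proof -
  obtain U where U: "continuous_on (sphere 0 1) U" "\<And>t. U (cis (\<omega> * t)) = h t"
    using periodic_on_circle assms by blast
  obtain g where g: "real_polynomial_function g" "\<And>z. z \<in> sphere 0 1 \<Longrightarrow> \<bar>U z - g z\<bar> < \<epsilon>"
    using Stone_Weierstrass_real_polynomial_function[OF compact_sphere U(1) assms(3)] by blast
  obtain K d where Kd: "finite K" "\<And>t. g (cis (\<omega> * t)) = (\<Sum>k\<in>K. d k * hart k t)"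
    using span_hart_explicit[OF real_polynomial_cis_mem_span[OF g(1)]] by metis
  show thesis
  proof
    show "\<bar>h t - (\<Sum>k\<in>K. d k * hart k t)\<bar> < \<epsilon>" for t
      using g(2)[of "cis (\<omega> * t)"] by (simp add: U(2) Kd(2))
  qed (rule Kd(1))
qed

text \<open>A uniform approximation by a polynomial bounds the square-mean error, and the
  coefficients of \<open>h\<close> itself give the least such error on the same index set. The set
  is made symmetric so that later sums can be reflected from \<open>k\<close> to
  \<open>- k\<close>.\<close>

lemma parseval_upper:
  assumes cont: "continuous_on UNIV h" and per: "\<And>t. h (t + T) = h t" and "\<epsilon> > 0"
  obtains K where "finite K" "uminus ` K = K" "(\<integral>t. (h t)\<^sup>2 \<partial>M) \<le> (\<Sum>k\<in>K. (coeff h k)\<^sup>2) / T + \<epsilon>"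
proof -
  \<comment> \<open>Makes the squared error, integrated over one period, equal to
    \<epsilon>.\<close>
  define \<delta> where "\<delta> = sqrt (\<epsilon> / T)"
  have \<delta>: "\<delta> > 0" "\<delta>\<^sup>2 * T = \<epsilon>"
    using T_pos assms(3) by (auto simp: \<delta>_def)
  obtain K d where K: "finite K" and d: "\<And>t. \<bar>h t - (\<Sum>k\<in>K. d k * hart k t)\<bar> < \<delta>"
    using hart_dense[OF cont per \<delta>(1)] by metis
  have h: "L2 M h" by (rule L2_continuous[OF cont])
  have "(\<integral>t. (h t)\<^sup>2 \<partial>M) - (\<Sum>k\<in>K. (coeff h k)\<^sup>2) / T
      \<le> (\<integral>t. (h t)\<^sup>2 \<partial>M) - (\<Sum>k\<in>K. (coeff h k)\<^sup>2) / T + (\<Sum>k\<in>K. (T * d k - coeff h k)\<^sup>2) / T"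
    using T_pos by (simp add: sum_nonneg)
  also have "\<dots> = (\<integral>t. (h t - (\<Sum>k\<in>K. d k * hart k t))\<^sup>2 \<partial>M)"
    by (rule integral_square_diff_hart_sum[OF K h, symmetric])
  also have "\<dots> \<le> (\<integral>t. \<delta>\<^sup>2 \<partial>M)"
  proof (rule integral_mono)
    show "integrable M (\<lambda>t. (h t - (\<Sum>k\<in>K. d k * hart k t))\<^sup>2)"
      by (intro L2_square L2_diff h L2_sum L2_cmult L2_hart)
    show "(h t - (\<Sum>k\<in>K. d k * hart k t))\<^sup>2 \<le> \<delta>\<^sup>2" for t
      using power_mono[OF less_imp_le[OF d[of t]], of 2] by simp
  qed simp
  also have "\<dots> = \<epsilon>" using \<delta>(2) by (simp only: integral_const)
  finally have le: "(\<integral>t. (h t)\<^sup>2 \<partial>M) \<le> (\<Sum>k\<in>K. (coeff h k)\<^sup>2) / T + \<epsilon>" by simp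
  show thesis
  proof (rule that[of "K \<union> uminus ` K"])
    have "(\<Sum>k\<in>K. (coeff h k)\<^sup>2) \<le> (\<Sum>k\<in>K \<union> uminus ` K. (coeff h k)\<^sup>2)"
      using K by (intro sum_mono2) auto
    then have "(\<Sum>k\<in>K. (coeff h k)\<^sup>2) / T \<le> (\<Sum>k\<in>K \<union> uminus ` K. (coeff h k)\<^sup>2) / T"
      using T_pos by (intro divide_right_mono) auto
    with le show "(\<integral>t. (h t)\<^sup>2 \<partial>M) \<le> (\<Sum>k\<in>K \<union> uminus ` K. (coeff h k)\<^sup>2) / T + \<epsilon>"
      by linarith
  qed (use K in \<open>auto simp: image_Un image_image\<close>)
qed

section \<open>Weak derivatives of periodic functions\<close>

text \<open>Integration by parts tested against the basis only: the derivative of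
  \<open>hart k\<close> is \<open>k * \<omega> * hart (- k)\<close>. The estimates below see the
  derivative only through its coefficients.\<close>

definition hart_derivative :: "(real \<Rightarrow> real) \<Rightarrow> (real \<Rightarrow> real) \<Rightarrow> bool"
  where "hart_derivative h h' \<longleftrightarrow> (\<forall>k. coeff h' k = - (of_int k * \<omega>) * coeff h (- k))"

text \<open>Parseval's upper bound for \<open>h\<close> meets Bessel's lower bound for
  \<open>h' + s * h\<close>; in the latter the mixed terms are odd in the index and cancel over a
  symmetric set. The case \<open>s = 0\<close> is Wirtinger's inequality; the case
  \<open>m = 0\<close>, for all \<open>s\<close>, gives the orthogonality of \<open>h\<close> and
  \<open>h'\<close>.\<close>

lemma hart_derivative_square_ge:
  assumes cont: "continuous_on UNIV h" and per: "\<And>t. h (t + T) = h t"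
    and h': "L2 M h'" "hart_derivative h h'"
    and m: "0 \<le> m" "\<And>k. \<bar>k\<bar> < m \<Longrightarrow> coeff h k = 0"
  shows "(s\<^sup>2 + (of_int m * \<omega>)\<^sup>2) * (\<integral>t. (h t)\<^sup>2 \<partial>M) \<le> (\<integral>t. (h' t + s * h t)\<^sup>2 \<partial>M)"
    (is "?C * ?I \<le> ?R")
proof (rule field_le_epsilon)
  fix e :: real assume "e > 0"
  have C: "?C \<ge> 0" by simp
  have h: "L2 M h" by (rule L2_continuous[OF cont])
  \<comment> \<open>Adding 1 avoids a division by zero and keeps \<open>?C\<close> times the
    quotient at most \<open>e\<close>.\<close>
  have C1: "?C + 1 > 0" using C by linarith
  have "e / (?C + 1) > 0" using \<open>e > 0\<close> C1 by (rule divide_pos_pos)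
  then obtain K where K: "finite K" "uminus ` K = K"
    "?I \<le> (\<Sum>k\<in>K. (coeff h k)\<^sup>2) / T + e / (?C + 1)"
    using parseval_upper[OF cont per] by metis
  have reflect: "(\<Sum>k\<in>K. f (- k)) = (\<Sum>k\<in>K. f k)" for f :: "int \<Rightarrow> real"
    using sum.reindex[of uminus K f] K(2) by simp
  have cf: "coeff (\<lambda>t. h' t + s * h t) k = - (of_int k * \<omega>) * coeff h (- k) + s * coeff h k" for k
    using h' h by (simp add: coeff_add L2_cmult coeff_cmult hart_derivative_def)
  \<comment> \<open>The sum of the mixed terms changes sign under reflection of the index.\<close>
  define X where "X = (\<Sum>k\<in>K. of_int k * (coeff h (- k) * coeff h k))"
  have "X = - X"
    using reflect[of "\<lambda>k. of_int k * (coeff h (- k) * coeff h k)"]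
    by (simp add: X_def mult.commute sum_negf)
  then have X: "X = 0" by simp
  have "?C * (\<Sum>k\<in>K. (coeff h k)\<^sup>2) = (\<Sum>k\<in>K. ?C * (coeff h k)\<^sup>2)"
    by (simp add: sum_distrib_left)
  also have "\<dots> \<le> (\<Sum>k\<in>K. (s\<^sup>2 + (of_int k * \<omega>)\<^sup>2) * (coeff h k)\<^sup>2)"
  proof (rule sum_mono)
    fix k
    show "?C * (coeff h k)\<^sup>2 \<le> (s\<^sup>2 + (of_int k * \<omega>)\<^sup>2) * (coeff h k)\<^sup>2"
    proof (cases "\<bar>k\<bar> < m")
      case False
      then have "(of_int m)\<^sup>2 \<le> (of_int k :: real)\<^sup>2"
        using m(1) by (intro abs_le_square_iff[THEN iffD1]) auto
      then show ?thesis
        by (intro mult_right_mono add_left_mono) (auto simp: power_mult_distrib mult_right_mono)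
    qed (simp add: m(2))
  qed
  also have "\<dots> = (\<Sum>k\<in>K. (of_int k * \<omega> * coeff h k)\<^sup>2) + (\<Sum>k\<in>K. (s * coeff h k)\<^sup>2)"
    by (simp add: sum.distrib[symmetric] power_mult_distrib algebra_simps)
  also have "(\<Sum>k\<in>K. (of_int k * \<omega> * coeff h k)\<^sup>2) = (\<Sum>k\<in>K. (of_int k * \<omega> * coeff h (- k))\<^sup>2)"
    using reflect[of "\<lambda>k. (of_int k * \<omega> * coeff h k)\<^sup>2"] by simp
  also have "\<dots> + (\<Sum>k\<in>K. (s * coeff h k)\<^sup>2)
      = (\<Sum>k\<in>K. (coeff (\<lambda>t. h' t + s * h t) k)\<^sup>2) + 2 * \<omega> * s * X"
    by (simp add: cf X_def sum.distrib[symmetric] sum_distrib_left power2_eq_square algebra_simps)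
  also have "\<dots> \<le> T * ?R"
    using bessel_inequality[OF K(1), of "\<lambda>t. h' t + s * h t"] T_pos h h'(1)
    by (simp add: X L2_add L2_cmult field_simps)
  finally have "?C * ((\<Sum>k\<in>K. (coeff h k)\<^sup>2) / T) \<le> ?R"
    using T_pos by (simp add: field_simps)
  moreover have "?C * ?I \<le> ?C * ((\<Sum>k\<in>K. (coeff h k)\<^sup>2) / T + e / (?C + 1))"
    using K(3) C by (rule mult_left_mono)
  moreover have "?C * (e / (?C + 1)) \<le> e"
    using C1 \<open>e > 0\<close> by (simp add: divide_le_eq algebra_simps del: add_pos_pos)
  ultimately show "?C * ?I \<le> ?R + e"
    by (simp add: distrib_left)
qed

text \<open>With \<open>m = 0\<close> the preceding bound cancels the quadratic term in
  \<open>s\<close>; what remains is affine in \<open>s\<close> and nonnegative everywhere, so its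
  slope vanishes.\<close>

lemma integral_times_hart_derivative:
  assumes cont: "continuous_on UNIV h" and per: "\<And>t. h (t + T) = h t"
    and h': "L2 M h'" "hart_derivative h h'"
  shows "(\<integral>t. h t * h' t \<partial>M) = 0"
proof -
  have h: "L2 M h" by (rule L2_continuous[OF cont])
  let ?A = "\<integral>t. (h' t)\<^sup>2 \<partial>M" and ?B = "\<integral>t. h t * h' t \<partial>M"
  have *: "0 \<le> ?A + 2 * s * ?B" for s
  proof -
    have sq: "(x + s * y)\<^sup>2 = x\<^sup>2 + 2 * s * (y * x) + s\<^sup>2 * y\<^sup>2" for x y :: real
      by (simp add: power2_eq_square algebra_simps)
    have "(\<integral>t. (h' t + s * h t)\<^sup>2 \<partial>M) = ?A + 2 * s * ?B + s\<^sup>2 * (\<integral>t. (h t)\<^sup>2 \<partial>M)"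
      unfolding sq using L2_square[OF h] L2_square[OF h'(1)] L2_mult[OF h h'(1)] by simp
    moreover have "s\<^sup>2 * (\<integral>t. (h t)\<^sup>2 \<partial>M) \<le> (\<integral>t. (h' t + s * h t)\<^sup>2 \<partial>M)"
      using hart_derivative_square_ge[OF cont per h', of 0 s] by simp
    ultimately show ?thesis by simp
  qed
  show "?B = 0"
  proof (rule ccontr)
    assume B: "?B \<noteq> 0"
    \<comment> \<open>At this value of \<open>s\<close> the affine function equals
      \<open>-1\<close>.\<close>
    have "2 * (- (?A + 1) / (2 * ?B)) * ?B = - (?A + 1)"
      using B by simp
    with *[of "- (?A + 1) / (2 * ?B)"] show False by simp
  qed
qed

end

section \<open>Completeness of the Hartley basis\<close>

text \<open>Continuous functions decreasing to the indicator of a closed set carry integral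
  identities over from continuous functions to closed sets.\<close>

lemma max_infdist_tendsto_indicator:
  assumes "closed S" "S \<noteq> {}"
  shows "(\<lambda>n. max 0 (1 - real n * infdist z S)) \<longlonglongrightarrow> indicator S z"
proof (cases "z \<in> S")
  case True
  then show ?thesis by simp
next
  case False
  then have pos: "infdist z S > 0"
    using assms by (simp add: infdist_pos_not_in_closed)
  then obtain N :: nat where N: "1 < real N * infdist z S"
    using reals_Archimedean3 by blast
  have "\<forall>\<^sub>F n in sequentially. max 0 (1 - real n * infdist z S) = indicator S z"
    using eventually_ge_at_top[of N]
  proof eventually_elim
    case (elim n)
    then have "real N * infdist z S \<le> real n * infdist z S"
      using pos by simp
    with N False show ?case by simp
  qed
  then show ?thesis by (rule tendsto_eventually)
qed

lemma measurable_lborel_upto: "f \<in> borel_measurable borel \<Longrightarrow> f \<in> borel_measurable (lborel_upto T)"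
  by (intro measurable_restrict_space1) simp

context frequency
begin

text \<open>Trigonometric polynomials integrate to zero against \<open>f\<close>, and a uniform
  approximation costs at most its error times the integral of the absolute value of
  \<open>f\<close>.\<close>

lemma integral_periodic_times_eq_0:
  assumes f: "L2 M f" "\<And>k. coeff f k = 0" and h: "continuous_on UNIV h" "\<And>t. h (t + T) = h t"
  shows "(\<integral>t. h t * f t \<partial>M) = 0"
proof -
  let ?A = "\<integral>t. \<bar>f t\<bar> \<partial>M"
  have A: "?A \<ge> 0" by simp
  have h2: "L2 M h" by (rule L2_continuous[OF h(1)])
  have "\<bar>\<integral>t. h t * f t \<partial>M\<bar> \<le> 0 + e" if e: "e > 0" for e
  proof -
    have A1: "?A + 1 > 0" using A by linarith
    have "e / (?A + 1) > 0" using e A1 by (rule divide_pos_pos)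
    then obtain K d where K: "finite K"
      and d: "\<And>t. \<bar>h t - (\<Sum>k\<in>K. d k * hart k t)\<bar> < e / (?A + 1)"
      using hart_dense[OF h] by metis
    let ?p = "\<lambda>t. \<Sum>k\<in>K. d k * hart k t"
    have p: "L2 M ?p" by (intro L2_sum L2_cmult L2_hart)
    have "(\<integral>t. ?p t * f t \<partial>M) = (\<integral>t. (\<Sum>k\<in>K. d k * (hart k t * f t)) \<partial>M)"
      by (simp add: sum_distrib_right mult.assoc)
    also have "\<dots> = (\<Sum>k\<in>K. d k * coeff f k)"
      by (subst Bochner_Integration.integral_sum) (auto simp: coeff_def intro!: coeff_integrable f)
    finally have "(\<integral>t. ?p t * f t \<partial>M) = 0" by (simp add: f(2))
    then have "\<bar>\<integral>t. h t * f t \<partial>M\<bar> = \<bar>\<integral>t. (h t - ?p t) * f t \<partial>M\<bar>"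
      using L2_mult[OF h2 f(1)] L2_mult[OF p f(1)] by (simp add: left_diff_distrib)
    also have "\<dots> \<le> (\<integral>t. \<bar>(h t - ?p t) * f t\<bar> \<partial>M)"
      by (rule integral_abs_bound)
    also have "\<dots> \<le> (\<integral>t. e / (?A + 1) * \<bar>f t\<bar> \<partial>M)"
    proof (rule integral_mono)
      show "integrable M (\<lambda>t. \<bar>(h t - ?p t) * f t\<bar>)"
        by (intro integrable_abs L2_mult L2_diff h2 p f)
      show "integrable M (\<lambda>t. e / (?A + 1) * \<bar>f t\<bar>)"
        using L2_integrable[OF f(1)] by simp
      show "\<bar>(h t - ?p t) * f t\<bar> \<le> e / (?A + 1) * \<bar>f t\<bar>" for t
        unfolding abs_mult by (rule mult_right_mono[OF less_imp_le[OF d]]) simp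
    qed
    also have "\<dots> = e / (?A + 1) * ?A" by simp
    also have "\<dots> \<le> e"
      using A1 e by (simp add: divide_le_eq algebra_simps del: add_pos_pos)
    finally show ?thesis by simp
  qed
  then have "\<bar>\<integral>t. h t * f t \<partial>M\<bar> \<le> 0" by (rule field_le_epsilon)
  then show ?thesis by simp
qed

text \<open>Working with closed sets of the circle keeps the approximating functions periodic, so
  the preceding lemma applies to them; dominated convergence gives the limit.\<close>

lemma integral_circle_indicator_eq_0:
  assumes f: "L2 M f" "\<And>k. coeff f k = 0" and S: "closed S" "S \<noteq> {}"
  shows "(\<integral>t. indicator S (cis (\<omega> * t)) * f t \<partial>M) = 0"
proof -
  let ?\<phi> = "\<lambda>n t. max 0 (1 - real n * infdist (cis (\<omega> * t)) S)"
  have cis_cont: "continuous_on UNIV (\<lambda>t. cis (\<omega> * t))"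
    by (intro continuous_intros)
  have \<phi>: "continuous_on UNIV (?\<phi> n)" for n
    by (intro continuous_intros)
  have [measurable]: "f \<in> borel_measurable M" using f(1) by measurable
  have [measurable]: "(\<lambda>t. cis (\<omega> * t)) \<in> borel_measurable M"
    by (intro measurable_lborel_upto borel_measurable_continuous_onI cis_cont)
  have [measurable]: "S \<in> sets borel" using S by simp
  have "cis (\<omega> * (t + T)) = cis (\<omega> * t)" for t
    by (simp add: distrib_left frequency_times_T complex_eq_iff)
  then have "(\<integral>t. ?\<phi> n t * f t \<partial>M) = 0" for n
    by (intro integral_periodic_times_eq_0 f \<phi>) simp
  moreover have "(\<lambda>n. \<integral>t. ?\<phi> n t * f t \<partial>M) \<longlonglongrightarrow> (\<integral>t. indicator S (cis (\<omega> * t)) * f t \<partial>M)"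
  proof (rule integral_dominated_convergence[where w = "\<lambda>t. \<bar>f t\<bar>"])
    show "integrable M (\<lambda>t. \<bar>f t\<bar>)" by (intro integrable_abs L2_integrable f)
    show "AE t in M. (\<lambda>n. ?\<phi> n t * f t) \<longlonglongrightarrow> indicator S (cis (\<omega> * t)) * f t"
      by (intro AE_I2 tendsto_mult_right max_infdist_tendsto_indicator S)
    show "AE t in M. norm (?\<phi> n t * f t) \<le> \<bar>f t\<bar>" for n
    proof (rule AE_I2)
      fix t
      have "\<bar>?\<phi> n t\<bar> \<le> 1" using infdist_nonneg[of "cis (\<omega> * t)" S] by simp
      then show "norm (?\<phi> n t * f t) \<le> \<bar>f t\<bar>"
        unfolding real_norm_def abs_mult by (rule mult_left_le_one_le[rotated 2]) auto
    qed
  next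
    show "(\<lambda>t. ?\<phi> n t * f t) \<in> borel_measurable M" for n
      by (rule borel_measurable_times[OF measurable_lborel_upto[OF borel_measurable_continuous_onI[OF \<phi>]]]) measurable
  qed measurable
  ultimately show ?thesis by (simp add: LIMSEQ_const_iff)
qed

lemma cis_frequency_inj:
  assumes "cis (\<omega> * s) = cis (\<omega> * t)" "\<bar>s - t\<bar> < T"
  shows "s = t"
proof -
  have "sin (\<omega> * s) = sin (\<omega> * t) \<and> cos (\<omega> * s) = cos (\<omega> * t)"
    using assms(1) by (simp add: complex_eq_iff)
  then obtain n :: int where "\<omega> * s = \<omega> * t + 2 * pi * of_int n"
    using sin_cos_eq_iff by blast
  then have *: "s - t = of_int n * T"
    using frequency_pos by (simp add: T_def field_simps)
  then have "\<bar>of_int n\<bar> * T < 1 * T"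
    using assms(2) T_pos by (simp add: abs_mult)
  then have "\<bar>of_int n :: real\<bar> < 1" using T_pos by (simp only: mult_less_cancel_right_pos)
  then have "n = 0" by linarith
  with * show ?thesis by simp
qed

text \<open>The part of the interval within one period has a compact image on the circle, whose
  preimage in that period is the same part again, up to the end points 0 and
  \<open>T\<close>.\<close>

lemma integral_interval_eq_0:
  assumes f: "L2 M f" "\<And>k. coeff f k = 0"
  shows "(\<integral>t. indicator {a..b} t * f t \<partial>M) = 0"
proof (cases "max 0 a \<le> min T b")
  case True
  let ?J = "{max 0 a..min T b}"
  let ?S = "(\<lambda>t. cis (\<omega> * t)) ` ?J"
  have "compact ?S"
    by (intro compact_continuous_image continuous_intros) simp
  moreover have "?S \<noteq> {}" using True by simp
  ultimately have "(\<integral>t. indicator ?S (cis (\<omega> * t)) * f t \<partial>M) = 0"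
    by (intro integral_circle_indicator_eq_0 f compact_imp_closed)
  also have "(\<integral>t. indicator ?S (cis (\<omega> * t)) * f t \<partial>M) = (\<integral>t. indicator {a..b} t * f t \<partial>M)"
  proof (rule integral_cong_AE)
    have [measurable]: "f \<in> borel_measurable M" using f(1) by measurable
    have [measurable]: "(\<lambda>t. cis (\<omega> * t)) \<in> borel_measurable M"
      by (intro measurable_lborel_upto borel_measurable_continuous_onI continuous_intros)
    have [measurable]: "?S \<in> sets borel"
      using \<open>compact ?S\<close> by (simp add: borel_compact)
    show "(\<lambda>t. indicator ?S (cis (\<omega> * t)) * f t) \<in> borel_measurable M" by measurable
    show "(\<lambda>t. indicator {a..b} t * f t) \<in> borel_measurable M"
      by (rule borel_measurable_times[OF measurable_lborel_upto]) auto
    \<comment> \<open>The end points are excluded since both go to the point 1, which may lie in the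
      image because of only one of them.\<close>
    have eq: "indicator ?S (cis (\<omega> * t)) = (indicator {a..b} t :: real)"
      if "t \<in> {0..T}" "t \<noteq> 0" "t \<noteq> T" for t
    proof -
      have "cis (\<omega> * t) \<in> ?S \<longleftrightarrow> t \<in> ?J"
        using that cis_frequency_inj[of t] by (force simp: image_iff)
      also have "\<dots> \<longleftrightarrow> t \<in> {a..b}" using that by auto
      finally show ?thesis by (simp add: indicator_def)
    qed
    show "AE t in M. indicator ?S (cis (\<omega> * t)) * f t = indicator {a..b} t * f t"
      using AE_lborel_upto_neq[where T = T and c = 0] AE_lborel_upto_neq[where T = T and c = T] AE_space
      by eventually_elim (simp add: space_restrict_space eq)
  qed
  finally show ?thesis .
next
  case False
  then have "indicator {a..b} t = (0::real)" if "t \<in> {0..T}" for t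
    using that by (auto simp: indicator_def)
  then have "(\<integral>t. indicator {a..b} t * f t \<partial>M) = (\<integral>t. 0 \<partial>M)"
    by (intro Bochner_Integration.integral_cong) (auto simp: space_restrict_space)
  then show ?thesis by simp
qed

text \<open>The Borel sets over which \<open>f\<close> integrates to zero form a Dynkin system
  containing the closed intervals, which are stable under intersection and generate the Borel sets.
  A function whose integrals over all of them vanish is zero almost everywhere.\<close>

lemma hart_complete:
  assumes f: "L2 M f" "\<And>k. coeff f k = 0"
  shows "AE t in M. f t = 0"
proof -
  have fi: "integrable M f" by (rule L2_integrable[OF f(1)])
  have fm [measurable]: "f \<in> borel_measurable M" using f(1) by measurable
  have ind [measurable]: "(\<lambda>t. indicator A t :: real) \<in> borel_measurable M" if "A \<in> sets borel" for A
    using that by (intro measurable_lborel_upto) simp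
  have ifi: "integrable M (\<lambda>t. indicator A t * f t)" if "A \<in> sets borel" for A
    by (rule Bochner_Integration.integrable_bound[OF fi])
      (use ind[OF that] in \<open>auto simp: indicator_def\<close>)
  have sets: "sets (borel :: real measure) = sigma_sets UNIV (range (\<lambda>(a, b). {a..b}))"
    by (subst borel_eq_atLeastAtMost) simp
  have Pow: "range (\<lambda>(a, b). {a..b::real}) \<subseteq> Pow UNIV" by simp
  have Int: "Int_stable (range (\<lambda>(a, b). {a..b::real}))"
  proof (rule Int_stableI_image)
    fix i j :: "real \<times> real"
    show "\<exists>k\<in>UNIV. (case i of (a, b) \<Rightarrow> {a..b}) \<inter> (case j of (a, b) \<Rightarrow> {a..b}) = (case k of (a, b) \<Rightarrow> {a..b})"
      by (rule bexI[of _ "(max (fst i) (fst j), min (snd i) (snd j))"]) (auto simp: split_beta)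
  qed
  have *: "(\<integral>t. indicator A t * f t \<partial>M) = 0" if "A \<in> sets borel" for A :: "real set"
  proof -
    have "A \<in> sigma_sets UNIV (range (\<lambda>(a, b). {a..b}))" using that by (simp add: sets)
    then show ?thesis
    proof (induction rule: sigma_sets_induct_disjoint[OF Int Pow, consumes 1, case_names basic empty compl union])
      case (compl A)
      \<comment> \<open>On the space of \<open>M\<close> the whole line may be replaced by
        \<open>{0..T}\<close>, an interval.\<close>
      have "(\<integral>t. indicator (UNIV - A) t * f t \<partial>M) = (\<integral>t. indicator {0..T} t * f t - indicator A t * f t \<partial>M)"
        by (intro Bochner_Integration.integral_cong) (auto simp: space_restrict_space indicator_def)
      also have "\<dots> = (\<integral>t. indicator {0..T} t * f t \<partial>M) - (\<integral>t. indicator A t * f t \<partial>M)"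
        using compl by (intro Bochner_Integration.integral_diff ifi) (simp_all flip: sets)
      finally show ?case
        using compl integral_interval_eq_0[OF f, of 0 T] by simp
    next
      case (union A)
      have A: "A i \<in> sets borel" for i using union by (auto simp: sets)
      \<comment> \<open>The finite unions increase to the whole one; disjointness turns their
        integrals into finite sums.\<close>
      have "(\<lambda>n. \<integral>t. indicator (\<Union>i<n. A i) t * f t \<partial>M) \<longlonglongrightarrow> (\<integral>t. indicator (\<Union>i. A i) t * f t \<partial>M)"
      proof (rule integral_dominated_convergence[where w = "\<lambda>t. \<bar>f t\<bar>"])
        show "AE t in M. (\<lambda>n. indicator (\<Union>i<n. A i) t * f t) \<longlonglongrightarrow> indicator (\<Union>i. A i) t * f t"
          by (intro AE_I2 tendsto_mult_right LIMSEQ_indicator_UN)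
        show "AE t in M. norm (indicator (\<Union>i<n. A i) t * f t) \<le> \<bar>f t\<bar>" for n
          by (auto simp: indicator_def)
        show "(\<lambda>t. indicator (\<Union>i. A i) t * f t) \<in> borel_measurable M"
          "(\<lambda>t. indicator (\<Union>i<n. A i) t * f t) \<in> borel_measurable M" for n
          using A by (intro borel_measurable_times ind fm; auto)+
      qed (use fi in auto)
      moreover have "(\<integral>t. indicator (\<Union>i<n. A i) t * f t \<partial>M) = 0" for n
      proof -
        have "indicator (\<Union>i<n. A i) t = (\<Sum>i<n. indicator (A i) t :: real)" for t
          using union(1) by (intro indicator_UN_disjoint) (auto simp: disjoint_family_on_def)
        then have "(\<integral>t. indicator (\<Union>i<n. A i) t * f t \<partial>M) = (\<integral>t. (\<Sum>i<n. indicator (A i) t * f t) \<partial>M)"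
          by (simp add: sum_distrib_right)
        also have "\<dots> = (\<Sum>i<n. \<integral>t. indicator (A i) t * f t \<partial>M)"
          using A by (intro Bochner_Integration.integral_sum ifi)
        finally show ?thesis using union by simp
      qed
      ultimately show ?case by (simp add: LIMSEQ_const_iff)
    qed (auto intro: integral_interval_eq_0[OF f])
  qed
  show ?thesis
  proof (rule density_unique_real)
    fix A assume "A \<in> sets M"
    then have "A \<in> sets borel" by (auto simp: sets_restrict_space)
    then show "(\<integral>t\<in>A. f t \<partial>M) = (\<integral>t\<in>A. 0 \<partial>M)"
      using *[of A] by (simp add: set_lebesgue_integral_def)
  qed (use fi in auto)
qed

end

section \<open>Periodic Sobolev functions in a rotating frame\<close>

lemma has_derivative_two_cosines:
  fixes A B \<mu> \<nu> c d :: real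
  shows
  "((\<lambda>t. A * cos (\<mu> * t + c) + B * cos (\<nu> * t + d)) has_real_derivative
    (A * \<mu>) * cos (\<mu> * t + (c + pi / 2)) + (B * \<nu>) * cos (\<nu> * t + (d + pi / 2))) (at t)"
  by (auto intro!: derivative_eq_intros simp: cos_add sin_add distrib_left algebra_simps)

text \<open>Each derivative multiplies the amplitudes by the frequencies and advances the phases by
  a quarter turn, so this class of functions is closed under \<open>deriv\<close>. Two summands are
  enough for the product of a basis element with a cosine of frequency \<omega>.\<close>

lemma iterated_deriv_two_cosines:
  fixes A B \<mu> \<nu> c d :: real
  shows
  "\<exists>A' c' B' d'. (deriv ^^ n) (\<lambda>t. A * cos (\<mu> * t + c) + B * cos (\<nu> * t + d))
    = (\<lambda>t. A' * cos (\<mu> * t + c') + B' * cos (\<nu> * t + d'))"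
proof (induction n)
  case 0
  show ?case by (simp, blast)
next
  case (Suc n)
  then obtain A' c' B' d' where "(deriv ^^ n) (\<lambda>t. A * cos (\<mu> * t + c) + B * cos (\<nu> * t + d))
      = (\<lambda>t. A' * cos (\<mu> * t + c') + B' * cos (\<nu> * t + d'))"
    by blast
  then have "(deriv ^^ Suc n) (\<lambda>t. A * cos (\<mu> * t + c) + B * cos (\<nu> * t + d))
      = deriv (\<lambda>t. A' * cos (\<mu> * t + c') + B' * cos (\<nu> * t + d'))"
    by simp
  also have "\<dots> = (\<lambda>t. (A' * \<mu>) * cos (\<mu> * t + (c' + pi / 2)) + (B' * \<nu>) * cos (\<nu> * t + (d' + pi / 2)))"
    by (rule ext) (rule DERIV_imp_deriv[OF has_derivative_two_cosines])
  finally show ?case by blast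
qed

lemma vector_2_eq: "vector [a, b] = a *\<^sub>R axis 1 1 + b *\<^sub>R (axis 2 1 :: real ^ 2)"
  by (simp add: vec_eq_iff forall_2 axis_def)

lemma vector_2_has_vector_derivative:
  assumes "(f has_real_derivative f') (at t)" "(g has_real_derivative g') (at t)"
  shows "((\<lambda>t. vector [f t, g t] :: real ^ 2) has_vector_derivative vector [f', g']) (at t)"
  unfolding vector_2_eq
  by (intro has_vector_derivative_add
      bounded_linear.has_vector_derivative[OF bounded_linear_scaleR_left]
      assms[unfolded has_real_derivative_iff_has_vector_derivative])

lemma continuous_on_vector_2:
  assumes "continuous_on S f" "continuous_on S g"
  shows "continuous_on S (\<lambda>t. vector [f t, g t] :: real ^ 2)"
  unfolding vector_2_eq by (intro continuous_intros assms)

lemma norm_square_vec_2: "(norm (v :: real ^ 2))\<^sup>2 = (v $ 1)\<^sup>2 + (v $ 2)\<^sup>2"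
  by (simp add: norm_vec_def L2_set_def sum_2)

lemma square_integrable_iff:
  "square_integrable T g \<longleftrightarrow> g \<in> borel_measurable (lborel_upto T) \<and> L2 (lborel_upto T) (\<lambda>t. norm (g t))"
proof -
  have "set_borel_measurable lborel {0..T} g \<longleftrightarrow> g \<in> borel_measurable (lborel_upto T)"
    by (simp add: set_borel_measurable_def borel_measurable_restrict_space_iff)
  then show ?thesis
    unfolding square_integrable_def set_integrable_lborel_upto L2_def by auto
qed

lemma square_integrable_component:
  assumes "square_integrable T g"
  shows "L2 (lborel_upto T) (\<lambda>t. g t $ i)"
proof -
  have m: "g \<in> borel_measurable (lborel_upto T)" and n: "integrable (lborel_upto T) (\<lambda>t. (norm (g t))\<^sup>2)"
    using assms by (auto simp: square_integrable_iff L2_def)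
  have mi [measurable]: "(\<lambda>t. g t $ i) \<in> borel_measurable (lborel_upto T)"
    using m by (rule measurable_compose) (intro borel_measurable_continuous_onI continuous_intros)
  have "integrable (lborel_upto T) (\<lambda>t. (g t $ i)\<^sup>2)"
  proof (rule Bochner_Integration.integrable_bound[OF n])
    have "(v $ i)\<^sup>2 \<le> (norm v)\<^sup>2" for v :: "real ^ 2"
      using power_mono[OF component_le_norm_cart[of v i], of 2] by simp
    then show "AE t in lborel_upto T. norm ((g t $ i)\<^sup>2) \<le> norm ((norm (g t))\<^sup>2)"
      by simp
  qed measurable
  with mi show ?thesis by (simp add: L2_def)
qed

section \<open>Weak derivatives in the rotating frame\<close>

context frequency
begin

lemma test_function_two_cosines:
  "periodic_test_function T (\<lambda>t. A * cos (of_int k * \<omega> * t + c) + B * cos (of_int l * \<omega> * t + d))"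
  unfolding periodic_test_function_def
proof (intro conjI allI)
  fix n
  obtain A' c' B' d' where eq: "(deriv ^^ n) (\<lambda>t. A * cos ((of_int k * \<omega>) * t + c) + B * cos ((of_int l * \<omega>) * t + d))
      = (\<lambda>t. A' * cos ((of_int k * \<omega>) * t + c') + B' * cos ((of_int l * \<omega>) * t + d'))"
    using iterated_deriv_two_cosines[of n A "of_int k * \<omega>" c B "of_int l * \<omega>" d] by (elim exE) (rule that)
  show "(deriv ^^ n) (\<lambda>t. A * cos (of_int k * \<omega> * t + c) + B * cos (of_int l * \<omega> * t + d)) differentiable_on UNIV"
    unfolding eq differentiable_on_def
    by (rule ballI, rule differentiableI[OF has_field_derivative_imp_has_derivative[OF has_derivative_two_cosines]])
qed (simp only: cos_periodic)

lemma test_function_hart: "periodic_test_function T (hart k)"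
proof -
  have "hart k = (\<lambda>t. sqrt 2 * cos (of_int k * \<omega> * t + - (pi / 4)) + 0 * cos (of_int 0 * \<omega> * t + 0))"
    by (simp add: fun_eq_iff hart_eq_cos)
  then show ?thesis using test_function_two_cosines[of "sqrt 2" k "- (pi / 4)" 0 0 0] by metis
qed

text \<open>Test functions for the rotating components: the cosine belongs to the frame,
  \<open>hart k\<close> extracts the coefficient. The product is a sum of two cosines of index
  \<open>k + 1\<close> and \<open>k - 1\<close>.\<close>

lemma test_function_hart_cos: "periodic_test_function T (\<lambda>t. hart k t * cos (\<omega> * t + c))"
proof -
  have prod: "r * cos a * cos b = r / 2 * cos (a + b) + r / 2 * cos (a - b)" for r a b :: real
    by (simp add: cos_add cos_diff field_simps)
  have "hart k t * cos (\<omega> * t + c) = sqrt 2 / 2 * cos (of_int (k + 1) * \<omega> * t + (c - pi / 4))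
      + sqrt 2 / 2 * cos (of_int (k - 1) * \<omega> * t + (- c - pi / 4))" for t
  proof -
    have "of_int k * \<omega> * t - pi / 4 + (\<omega> * t + c) = of_int (k + 1) * \<omega> * t + (c - pi / 4)"
      "of_int k * \<omega> * t - pi / 4 - (\<omega> * t + c) = of_int (k - 1) * \<omega> * t + (- c - pi / 4)"
      by (simp_all add: algebra_simps)
    then show ?thesis by (simp only: hart_eq_cos prod)
  qed
  then have "(\<lambda>t. hart k t * cos (\<omega> * t + c)) = (\<lambda>t. sqrt 2 / 2 * cos (of_int (k + 1) * \<omega> * t + (c - pi / 4))
      + sqrt 2 / 2 * cos (of_int (k - 1) * \<omega> * t + (- c - pi / 4)))"
    by (rule ext)
  then show ?thesis
    using test_function_two_cosines[of "sqrt 2 / 2" "k + 1" "c - pi / 4" "sqrt 2 / 2" "k - 1" "- c - pi / 4"] by metis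
qed

lemma test_function_continuous:
  assumes "periodic_test_function T \<phi>"
  shows "continuous_on UNIV \<phi>" "continuous_on UNIV (deriv \<phi>)" "(\<phi> has_vector_derivative deriv \<phi> t) (at t)"
proof -
  have "(deriv ^^ k) \<phi> differentiable_on UNIV" for k
    using assms by (simp add: periodic_test_function_def)
  from this[of 0] this[of 1] have d: "\<phi> differentiable_on UNIV" "deriv \<phi> differentiable_on UNIV" by auto
  then show "continuous_on UNIV \<phi>" "continuous_on UNIV (deriv \<phi>)"
    by (auto intro: differentiable_imp_continuous_on)
  show "(\<phi> has_vector_derivative deriv \<phi> t) (at t)"
    using d(1) by (simp add: differentiable_on_def DERIV_deriv_iff_real_differentiable
        flip: has_real_derivative_iff_has_vector_derivative)
qed

definition weak_derivative :: "(real \<Rightarrow> real) \<Rightarrow> (real \<Rightarrow> real) \<Rightarrow> bool"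
  where "weak_derivative v h \<longleftrightarrow> (\<forall>\<phi>. periodic_test_function T \<phi> \<longrightarrow>
    (\<integral>t. deriv \<phi> t * v t \<partial>M) = - (\<integral>t. \<phi> t * h t \<partial>M))"

lemma integrable_scaleR_square_integrable:
  assumes "continuous_on UNIV \<phi>" "square_integrable T g"
  shows "integrable M (\<lambda>t. \<phi> t *\<^sub>R g t)"
proof (rule Bochner_Integration.integrable_bound)
  have g: "g \<in> borel_measurable M" "L2 M (\<lambda>t. norm (g t))"
    using assms(2) by (auto simp: square_integrable_iff)
  have \<phi>: "L2 M \<phi>" by (rule L2_continuous[OF assms(1)])
  show "integrable M (\<lambda>t. \<phi> t * norm (g t))" by (rule L2_mult[OF \<phi> g(2)])
  show "(\<lambda>t. \<phi> t *\<^sub>R g t) \<in> borel_measurable M"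
    by (rule borel_measurable_scaleR[OF L2_measurable[OF \<phi>] g(1)])
  show "AE t in M. norm (\<phi> t *\<^sub>R g t) \<le> norm (\<phi> t * norm (g t))"
    by (simp add: abs_mult)
qed

lemma has_weak_derivative_component:
  assumes "has_weak_derivative T u g" "continuous_on UNIV u" "square_integrable T g"
  shows "weak_derivative (\<lambda>t. u t $ i) (\<lambda>t. g t $ i)"
  unfolding weak_derivative_def
proof (intro allI impI)
  fix \<phi> assume \<phi>: "periodic_test_function T \<phi>"
  note c = test_function_continuous[OF \<phi>]
  have iu: "integrable M (\<lambda>t. deriv \<phi> t *\<^sub>R u t)"
    by (rule integrable_continuous_lborel_upto) (intro continuous_intros c assms)
  have ig: "integrable M (\<lambda>t. \<phi> t *\<^sub>R g t)"
    by (rule integrable_scaleR_square_integrable[OF c(1) assms(3)])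
  have "(\<integral>t. deriv \<phi> t *\<^sub>R u t \<partial>M) $ i = - (\<integral>t. \<phi> t *\<^sub>R g t \<partial>M) $ i"
    using assms(1) \<phi> by (simp add: has_weak_derivative_def set_integral_lborel_upto)
  then show "(\<integral>t. deriv \<phi> t * u t $ i \<partial>M) = - (\<integral>t. \<phi> t * g t $ i \<partial>M)"
    using integral_bounded_linear[OF bounded_linear_vec_nth iu, of i]
      integral_bounded_linear[OF bounded_linear_vec_nth ig, of i] by simp
qed

lemma hart_derivative_add:
  assumes "hart_derivative v v'" "hart_derivative w w'" "L2 M v" "L2 M v'" "L2 M w" "L2 M w'"
  shows "hart_derivative (\<lambda>t. v t + w t) (\<lambda>t. v' t + w' t)"
  using assms by (simp add: hart_derivative_def coeff_add distrib_left)

text \<open>The product rule in weak form: with \<open>hart k\<close> times the cosine as test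
  function the derivative falls on both factors, and the term from the cosine is carried to the
  other side. Advancing the phase by \<open>pi / 2\<close> differentiates the cosine up to the
  factor \<omega>.\<close>

lemma hart_derivative_cos_times:
  assumes v: "L2 M v" and h: "L2 M h" and w: "weak_derivative v h"
  shows "hart_derivative (\<lambda>t. cos (\<omega> * t + c) * v t)
    (\<lambda>t. cos (\<omega> * t + c) * h t + \<omega> * (cos (\<omega> * t + (c + pi / 2)) * v t))"
  unfolding hart_derivative_def
proof
  fix k
  let ?C = "\<lambda>t. cos (\<omega> * t + c)" and ?S = "\<lambda>t. cos (\<omega> * t + (c + pi / 2))"
  have L2: "L2 M (\<lambda>t. cos (\<omega> * t + d) * v t)" "L2 M (\<lambda>t. cos (\<omega> * t + d) * h t)" for d
    by (intro L2_trig_mult v h)+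
  have "((\<lambda>t. hart k t * ?C t) has_real_derivative
      of_int k * \<omega> * hart (- k) t * ?C t + hart k t * \<omega> * ?S t) (at t)" for t
    by (rule derivative_eq_intros hart_has_derivative refl)+ (simp add: cos_add sin_add algebra_simps)
  then have d: "deriv (\<lambda>t. hart k t * ?C t) = (\<lambda>t. of_int k * \<omega> * hart (- k) t * ?C t + hart k t * \<omega> * ?S t)"
    by (auto simp: fun_eq_iff intro!: DERIV_imp_deriv)
  have "(\<integral>t. of_int k * \<omega> * (hart (- k) t * (?C t * v t)) + \<omega> * (hart k t * (?S t * v t)) \<partial>M)
      = - (\<integral>t. hart k t * (?C t * h t) \<partial>M)"
  proof -
    have "(of_int k * \<omega> * hart (- k) t * ?C t + hart k t * \<omega> * ?S t) * v t
        = of_int k * \<omega> * (hart (- k) t * (?C t * v t)) + \<omega> * (hart k t * (?S t * v t))"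
      "hart k t * ?C t * h t = hart k t * (?C t * h t)" for t
      by (simp_all add: ring_distribs)
    with w[unfolded weak_derivative_def, rule_format, OF test_function_hart_cos[of k c], unfolded d]
    show ?thesis by (simp only:)
  qed
  then have "of_int k * \<omega> * coeff (\<lambda>t. ?C t * v t) (- k) + \<omega> * coeff (\<lambda>t. ?S t * v t) k
      = - coeff (\<lambda>t. ?C t * h t) k"
    using coeff_integrable[OF L2(1)] by (simp add: coeff_def)
  then show "coeff (\<lambda>t. ?C t * h t + \<omega> * (?S t * v t)) k = - (of_int k * \<omega>) * coeff (\<lambda>t. ?C t * v t) (- k)"
    by (simp add: coeff_add L2_cmult L2 coeff_cmult)
qed

text \<open>The frame consists of two unit vectors a quarter turn apart, so one definition with a
  variable angle yields both the radial and the tangential component.\<close>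

definition rotating_component :: "real \<Rightarrow> (real \<Rightarrow> real ^ 2) \<Rightarrow> real \<Rightarrow> real"
  where "rotating_component \<theta> u t = cos (\<omega> * t + \<theta>) * u t $ 1 + sin (\<omega> * t + \<theta>) * u t $ 2"

lemma rotating_component_eq_cos:
  "rotating_component \<theta> u t = cos (\<omega> * t + \<theta>) * u t $ 1 + cos (\<omega> * t + (\<theta> - pi / 2)) * u t $ 2"
  by (simp add: rotating_component_def sin_eq_cos_shift add_diff_eq)

text \<open>Differentiating the tangential frame vector gives a multiple of minus the radial one;
  two quarter turns account for this sign.\<close>

lemma rotating_component_add_pi:
  "rotating_component (\<theta> + pi / 2 + pi / 2) u t = - rotating_component \<theta> u t"
proof -
  have "\<omega> * t + (\<theta> + pi / 2 + pi / 2) = (\<omega> * t + \<theta>) + pi"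
    by simp
  then show ?thesis
    unfolding rotating_component_def by (simp only: cos_periodic_pi sin_periodic_pi)
qed

lemma norm_square_rotating:
  "(norm (u t))\<^sup>2 = (rotating_component \<theta> u t)\<^sup>2 + (rotating_component (\<theta> + pi / 2) u t)\<^sup>2"
proof -
  have eq: "(C * x + S * y)\<^sup>2 + (- S * x + C * y)\<^sup>2 = (S\<^sup>2 + C\<^sup>2) * (x\<^sup>2 + y\<^sup>2)" for C S x y :: real
    by (simp add: power2_eq_square algebra_simps)
  have "rotating_component (\<theta> + pi / 2) u t = - sin (\<omega> * t + \<theta>) * u t $ 1 + cos (\<omega> * t + \<theta>) * u t $ 2"
    by (simp add: rotating_component_def add.assoc[symmetric] cos_add[of _ "pi / 2"] sin_add[of _ "pi / 2"])
  then show ?thesis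
    by (simp only: rotating_component_def[of \<theta>] eq sin_cos_squared_add norm_square_vec_2 mult_1_left)
qed

lemma rotating_component_continuous:
  "continuous_on UNIV u \<Longrightarrow> continuous_on UNIV (rotating_component \<theta> u)"
  unfolding rotating_component_def[abs_def] by (intro continuous_intros)

lemma rotating_component_periodic:
  assumes "\<And>t. u (t + T) = u t"
  shows "rotating_component \<theta> u (t + T) = rotating_component \<theta> u t"
proof -
  have "cos (\<omega> * (t + T) + c) = cos (\<omega> * t + c)" for c
    using cos_periodic[of 1 t c] by (simp only: of_int_1 mult_1_left)
  then show ?thesis
    unfolding rotating_component_eq_cos assms by (simp only:)
qed

lemma L2_rotating_component:
  assumes "\<And>i. L2 M (\<lambda>t. g t $ i)"
  shows "L2 M (rotating_component \<theta> g)"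
  unfolding rotating_component_eq_cos[abs_def] by (intro L2_add L2_trig_mult assms)

text \<open>The frame vector at angle \<theta> has derivative \<omega> times the one a quarter turn
  further; the sine factor is treated as a cosine with phase
  \<open>\<theta> - pi / 2\<close>.\<close>

lemma rotating_component_hart_derivative:
  assumes "\<And>i. L2 M (\<lambda>t. u t $ i)" "\<And>i. L2 M (\<lambda>t. g t $ i)"
    and "\<And>i. weak_derivative (\<lambda>t. u t $ i) (\<lambda>t. g t $ i)"
  shows "hart_derivative (rotating_component \<theta> u)
    (\<lambda>t. rotating_component \<theta> g t + \<omega> * rotating_component (\<theta> + pi / 2) u t)"
proof -
  let ?D = "\<lambda>i c t. cos (\<omega> * t + c) * g t $ i + \<omega> * (cos (\<omega> * t + (c + pi / 2)) * u t $ i)"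
  have "hart_derivative (\<lambda>t. cos (\<omega> * t + \<theta>) * u t $ 1 + cos (\<omega> * t + (\<theta> - pi / 2)) * u t $ 2)
      (\<lambda>t. ?D 1 \<theta> t + ?D 2 (\<theta> - pi / 2) t)"
    by (intro hart_derivative_add hart_derivative_cos_times L2_add L2_cmult L2_trig_mult assms)
  moreover have "rotating_component \<theta> u = (\<lambda>t. cos (\<omega> * t + \<theta>) * u t $ 1 + cos (\<omega> * t + (\<theta> - pi / 2)) * u t $ 2)"
    by (rule ext) (rule rotating_component_eq_cos)
  moreover have "?D 1 \<theta> t + ?D 2 (\<theta> - pi / 2) t
      = rotating_component \<theta> g t + \<omega> * rotating_component (\<theta> + pi / 2) u t" for t
  proof -
    have "x + \<omega> * y + (x' + \<omega> * y') = x + x' + \<omega> * (y + y')" for x y x' y' :: real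
      by (simp add: distrib_left)
    then show ?thesis
      unfolding rotating_component_eq_cos diff_add_cancel add_diff_cancel_right' .
  qed
  ultimately show ?thesis by (simp only:)
qed

end

section \<open>The second variation at a circular solution\<close>

lemma norm_powr_has_derivative:
  fixes x :: "real ^ 'n"
  assumes "x \<noteq> 0"
  shows "((\<lambda>s. norm (x + s *\<^sub>R axis i 1) powr \<beta>) has_real_derivative \<beta> * norm x powr (\<beta> - 2) * x $ i) (at 0)"
proof -
  have l: "((\<lambda>s. x + s *\<^sub>R axis i 1) has_derivative (\<lambda>s. s *\<^sub>R axis i 1)) (at 0)"
    by (auto intro!: derivative_eq_intros)
  have "(norm has_derivative (\<lambda>h. sgn x \<bullet> h)) (at (x + 0 *\<^sub>R axis i 1))"
    using has_derivative_norm[OF assms] by (simp add: inner_commute)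
  from has_derivative_compose[OF l this]
  have "((\<lambda>s. norm (x + s *\<^sub>R axis i 1)) has_derivative (\<lambda>s. sgn x \<bullet> (s *\<^sub>R axis i 1))) (at 0)" .
  moreover have "(\<lambda>s. sgn x \<bullet> (s *\<^sub>R axis i 1)) = (*) (x $ i / norm x)"
    by (simp add: fun_eq_iff sgn_div_norm inner_axis field_simps)
  ultimately have "((\<lambda>s. norm (x + s *\<^sub>R axis i 1)) has_real_derivative x $ i / norm x) (at 0)"
    by (simp only: has_field_derivative_def)
  from DERIV_powr[OF this _ DERIV_const[of \<beta>]] assms
  have "((\<lambda>s. norm (x + s *\<^sub>R axis i 1) powr \<beta>) has_real_derivative
      norm x powr \<beta> * (x $ i / norm x * \<beta> / norm x)) (at 0)"
    by simp
  moreover have "norm x powr \<beta> * (x $ i / norm x * \<beta> / norm x) = \<beta> * norm x powr (\<beta> - 2) * x $ i"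
    using assms by (simp add: powr_diff powr_numeral power2_eq_square)
  ultimately show ?thesis by simp
qed

text \<open>Formulas valid off the origin hold near parameter 0 on every line through
  \<open>x\<close>, which is what differentiating them takes.\<close>

lemma eventually_line_nonzero:
  fixes x y :: "'a::real_normed_vector"
  assumes "x \<noteq> 0"
  shows "\<forall>\<^sub>F s in nhds (0::real). x + s *\<^sub>R y \<noteq> 0"
proof -
  have "isCont (\<lambda>s. x + s *\<^sub>R y) 0" by (intro continuous_intros)
  then have "((\<lambda>s. x + s *\<^sub>R y) \<longlongrightarrow> x) (nhds 0)"
    using tendsto_at_iff_tendsto_nhds[of "\<lambda>s. x + s *\<^sub>R y" 0] by (simp add: isCont_def)
  then show ?thesis using assms by (rule tendsto_imp_eventually_ne)
qed

section \<open>Second derivatives of the radial Lagrangian\<close>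

context
  fixes p q :: "real \<Rightarrow> real" and \<alpha> :: real
  assumes p: "\<And>\<xi>. \<xi> > 0 \<Longrightarrow> p \<xi> = 1" and q: "\<And>\<xi>. \<xi> > 0 \<Longrightarrow> q \<xi> = \<xi> powr \<alpha>"
begin

lemma partial_v_radial:
  assumes "x \<noteq> 0"
  shows "partial i (\<lambda>w. radial_lagrangian p q x w) v = v $ i"
proof -
  have "((\<lambda>s. (norm (v + s *\<^sub>R axis i 1))\<^sup>2 / 2 + c) has_real_derivative v $ i) (at 0)" for c
    unfolding power2_norm_eq_inner
    by (rule derivative_eq_intros refl
        | simp add: inner_axis inner_commute[of "axis i 1"] inner_add_left inner_add_right)+
  then show ?thesis
    using assms by (simp add: partial_def radial_lagrangian_def p DERIV_imp_deriv)
qed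

lemma partial_x_radial:
  assumes "x \<noteq> 0"
  shows "partial i (\<lambda>y. radial_lagrangian p q y v) x = \<alpha> * norm x powr (\<alpha> - 2) * x $ i"
proof -
  have "deriv (\<lambda>s. radial_lagrangian p q (x + s *\<^sub>R axis i 1) v) 0
      = deriv (\<lambda>s. (norm v)\<^sup>2 / 2 + norm (x + s *\<^sub>R axis i 1) powr \<alpha>) 0"
    by (intro deriv_cong_ev refl eventually_mono[OF eventually_line_nonzero[OF assms, of "axis i 1"]])
      (simp add: radial_lagrangian_def p q)
  also have "\<dots> = 0 + \<alpha> * norm x powr (\<alpha> - 2) * x $ i"
    by (intro DERIV_imp_deriv DERIV_add DERIV_const norm_powr_has_derivative assms)
  finally show ?thesis by (simp add: partial_def)
qed

lemma L_vv_radial: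
  assumes "x \<noteq> 0"
  shows "L_vv (radial_lagrangian p q) x v = mat 1"
proof -
  have "partial i (\<lambda>w. w $ j) v = (if i = j then 1 else 0)" for i j
  proof -
    have "((\<lambda>s. (v + s *\<^sub>R axis i 1) $ j) has_real_derivative axis i 1 $ j) (at 0)"
      by (auto intro!: derivative_eq_intros)
    then show ?thesis
      unfolding partial_def by (auto simp: DERIV_imp_deriv axis_def)
  qed
  then show ?thesis
    using assms by (simp add: L_vv_def partial_v_radial vec_eq_iff mat_def)
qed

lemma L_vx_radial:
  assumes "x \<noteq> 0"
  shows "L_vx (radial_lagrangian p q) x v = 0"
  using assms by (simp add: L_vx_def partial_x_radial vec_eq_iff) (simp add: partial_def)

text \<open>The Hessian of \<open>norm x powr \<alpha>\<close>: an isotropic part comes from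
  differentiating the factor \<open>x $ j\<close> of the gradient, a radial part from
  differentiating the power of the norm.\<close>

lemma L_xx_radial:
  assumes "x \<noteq> 0"
  shows "L_xx (radial_lagrangian p q) x v $ i $ j
    = \<alpha> * norm x powr (\<alpha> - 2) * (if i = j then 1 else 0) + \<alpha> * (\<alpha> - 2) * norm x powr (\<alpha> - 4) * x $ i * x $ j"
proof -
  have "deriv (\<lambda>s. partial j (\<lambda>y'. radial_lagrangian p q y' v) (x + s *\<^sub>R axis i 1)) 0
      = deriv (\<lambda>s. \<alpha> * (norm (x + s *\<^sub>R axis i 1) powr (\<alpha> - 2) * (x + s *\<^sub>R axis i 1) $ j)) 0"
    by (intro deriv_cong_ev refl eventually_mono[OF eventually_line_nonzero[OF assms, of "axis i 1"]])
      (simp add: partial_x_radial)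
  also have "\<dots> = \<alpha> * ((\<alpha> - 2) * norm x powr (\<alpha> - 2 - 2) * x $ i * x $ j + axis i 1 $ j * norm x powr (\<alpha> - 2))"
  proof (intro DERIV_imp_deriv DERIV_cmult)
    have "((\<lambda>s. (x + s *\<^sub>R axis i 1) $ j) has_real_derivative axis i 1 $ j) (at 0)"
      by (auto intro!: derivative_eq_intros)
    from DERIV_mult[OF norm_powr_has_derivative[OF assms, where \<beta> = "\<alpha> - 2"] this]
    show "((\<lambda>s. norm (x + s *\<^sub>R axis i 1) powr (\<alpha> - 2) * (x + s *\<^sub>R axis i 1) $ j) has_real_derivative
        (\<alpha> - 2) * norm x powr (\<alpha> - 2 - 2) * x $ i * x $ j + axis i 1 $ j * norm x powr (\<alpha> - 2)) (at 0)"
      by simp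
  qed
  also have "\<dots> = \<alpha> * norm x powr (\<alpha> - 2) * (if i = j then 1 else 0)
      + \<alpha> * (\<alpha> - 2) * norm x powr (\<alpha> - 4) * x $ i * x $ j"
    by (simp add: axis_def distrib_left)
  finally show ?thesis by (simp add: L_xx_def partial_def[of i])
qed

end

section \<open>The quadratic form in the rotating frame\<close>

context frequency
begin

text \<open>The second variation at a circular solution of frequency \<open>\<omega>\<close> and initial angle \<open>\<theta>\<close>; the
  components of \<open>u\<close> along \<open>x\<close> and orthogonal to it are \<open>rotating_component \<theta> u\<close> and
  \<open>rotating_component (\<theta> + pi / 2) u\<close>.\<close>

definition energy :: "real \<Rightarrow> real \<Rightarrow> (real \<Rightarrow> real ^ 2) \<Rightarrow> (real \<Rightarrow> real ^ 2) \<Rightarrow> real"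
  where "energy \<alpha> \<theta> u g =
    (\<integral>t. (norm (g t))\<^sup>2 - \<omega>\<^sup>2 * (norm (u t))\<^sup>2 + \<omega>\<^sup>2 * (2 - \<alpha>) * (rotating_component \<theta> u t)\<^sup>2 \<partial>M)"

text \<open>\<open>P\<close> is the identity and \<open>Q\<close> vanishes. The relation between
  \<omega> and \<xi> turns the isotropic coefficient of \<open>R\<close> into
  \<open>- \<omega>\<^sup>2\<close>, and the radial one into \<open>\<alpha> - 2\<close> times the
  same value, so that \<xi> drops out.\<close>

lemma second_variation_circular:
  assumes p: "\<And>\<xi>. \<xi> > 0 \<Longrightarrow> p \<xi> = 1" and q: "\<And>\<xi>. \<xi> > 0 \<Longrightarrow> q \<xi> = \<xi> powr \<alpha>"
    and \<xi>: "\<xi> > 0" and x: "x = (\<lambda>t. polar \<xi> (\<theta> + \<omega> * t))" and \<omega>: "\<omega>\<^sup>2 = - \<alpha> * \<xi> powr (\<alpha> - 2)"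
  shows "second_variation (radial_lagrangian p q) T x u = energy \<alpha> \<theta> u (weak_deriv T u)"
proof -
  let ?L = "radial_lagrangian p q"
  have x12: "x t $ 1 = \<xi> * cos (\<omega> * t + \<theta>)" "x t $ 2 = \<xi> * sin (\<omega> * t + \<theta>)" for t
    by (simp_all add: x polar_def add.commute)
  have "(norm (x t))\<^sup>2 = \<xi>\<^sup>2 * ((sin (\<omega> * t + \<theta>))\<^sup>2 + (cos (\<omega> * t + \<theta>))\<^sup>2)" for t
    by (simp only: norm_square_vec_2 x12 power_mult_distrib distrib_left add.commute)
  then have "(norm (x t))\<^sup>2 = \<xi>\<^sup>2" for t
    by (simp only: sin_cos_squared_add mult_1_right)
  then have nx: "norm (x t) = \<xi>" for t
    using \<xi> by (simp add: power2_eq_iff_nonneg)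
  then have x0: "x t \<noteq> 0" for t using \<xi> by (metis norm_zero less_irrefl)
  have pw: "\<alpha> * \<xi> powr (\<alpha> - 2) = - \<omega>\<^sup>2" "\<alpha> * \<xi> powr (\<alpha> - 4) * \<xi>\<^sup>2 = - \<omega>\<^sup>2"
  proof -
    have "\<xi> powr (\<alpha> - 4) * \<xi>\<^sup>2 = \<xi> powr (\<alpha> - 2)"
      using \<xi> by (simp add: powr_add[symmetric] flip: powr_numeral)
    then show "\<alpha> * \<xi> powr (\<alpha> - 2) = - \<omega>\<^sup>2" "\<alpha> * \<xi> powr (\<alpha> - 4) * \<xi>\<^sup>2 = - \<omega>\<^sup>2"
      using \<omega> by (simp_all add: mult.assoc)
  qed
  have R: "(L_xx ?L (x t) v *v w) \<bullet> w
      = - \<omega>\<^sup>2 * (norm w)\<^sup>2 + \<omega>\<^sup>2 * (2 - \<alpha>) * (cos (\<omega> * t + \<theta>) * w $ 1 + sin (\<omega> * t + \<theta>) * w $ 2)\<^sup>2" for t v w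
  proof -
    let ?A = "\<alpha> * \<xi> powr (\<alpha> - 2)" and ?B = "\<alpha> * \<xi> powr (\<alpha> - 4)"
    have "(L_xx ?L (x t) v *v w) \<bullet> w
        = ?A * ((w $ 1)\<^sup>2 + (w $ 2)\<^sup>2) + (\<alpha> - 2) * ?B * (x t $ 1 * w $ 1 + x t $ 2 * w $ 2)\<^sup>2"
      by (simp add: inner_vec_def matrix_vector_mult_def sum_2 L_xx_radial[OF p q x0] nx power2_eq_square)
        (simp add: algebra_simps)
    also have "\<dots> = ?A * (norm w)\<^sup>2
        + (\<alpha> - 2) * (?B * \<xi>\<^sup>2) * (cos (\<omega> * t + \<theta>) * w $ 1 + sin (\<omega> * t + \<theta>) * w $ 2)\<^sup>2"
      unfolding x12 norm_square_vec_2 by (simp add: power2_eq_square algebra_simps)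
    finally show ?thesis unfolding pw by (simp add: algebra_simps)
  qed
  have PQ: "L_vv ?L (x t) v = mat 1" "L_vx ?L (x t) v = 0" for t v
    by (rule L_vv_radial L_vx_radial; use p q x0 in auto)+
  show ?thesis
    unfolding second_variation_def Let_def energy_def set_integral_lborel_upto PQ R rotating_component_def
    by (simp add: power2_norm_eq_inner algebra_simps)
qed

text \<open>\<open>a'\<close> and \<open>b'\<close> are the derivatives of the components, not the
  components of the derivative \<open>g\<close>; the two differ by the rotation of the frame. After
  expansion the integrand differs from the sum of squares by a multiple of
  \<open>a * b' + b * a'\<close>, which integrates to zero.\<close>

lemma energy_rotating:
  fixes \<theta> :: real
  assumes u: "continuous_on UNIV u" "\<And>t. u (t + T) = u t"
    and g: "\<And>i. L2 M (\<lambda>t. g t $ i)" "\<And>i. weak_derivative (\<lambda>t. u t $ i) (\<lambda>t. g t $ i)"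
  defines "a \<equiv> rotating_component \<theta> u" and "b \<equiv> rotating_component (\<theta> + pi / 2) u"
  defines "a' \<equiv> \<lambda>t. rotating_component \<theta> g t + \<omega> * b t"
    and "b' \<equiv> \<lambda>t. rotating_component (\<theta> + pi / 2) g t - \<omega> * a t"
  shows "hart_derivative a a'" "hart_derivative b b'" "L2 M a'" "L2 M b'"
    and "energy \<alpha> \<theta> u g
      = (\<integral>t. (b' t + 2 * \<omega> * a t)\<^sup>2 \<partial>M) + (\<integral>t. (a' t)\<^sup>2 \<partial>M) - (2 + \<alpha>) * \<omega>\<^sup>2 * (\<integral>t. (a t)\<^sup>2 \<partial>M)"
proof -
  have ui: "L2 M (\<lambda>t. u t $ i)" for i
    by (intro L2_continuous continuous_intros u)
  have ab: "continuous_on UNIV a" "continuous_on UNIV b" "\<And>t. a (t + T) = a t" "\<And>t. b (t + T) = b t"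
    unfolding a_def b_def by (intro rotating_component_continuous rotating_component_periodic u)+
  note L2ab = ab(1,2)[THEN L2_continuous]
  have L2g: "L2 M (rotating_component c g)" for c
    by (rule L2_rotating_component[OF g(1)])
  show a': "L2 M a'" and b': "L2 M b'"
    unfolding a'_def b'_def by (intro L2_add L2_diff L2_cmult L2ab L2g)+
  show ha: "hart_derivative a a'"
    unfolding a'_def a_def b_def by (rule rotating_component_hart_derivative[OF ui g])
  show hb: "hart_derivative b b'"
    using rotating_component_hart_derivative[OF ui g, of "\<theta> + pi / 2"]
    unfolding rotating_component_add_pi a_def b_def b'_def by simp
  \<comment> \<open>Polarization: the orthogonality of a function and its derivative, for
    \<open>a\<close>, \<open>b\<close> and \<open>a + b\<close>, makes the integral of the mixed
    term vanish.\<close>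
  have i0: "(\<integral>t. a t * a' t \<partial>M) = 0" "(\<integral>t. b t * b' t \<partial>M) = 0"
    "(\<integral>t. (a t + b t) * (a' t + b' t) \<partial>M) = 0"
  proof -
    show "(\<integral>t. a t * a' t \<partial>M) = 0" "(\<integral>t. b t * b' t \<partial>M) = 0"
      by (rule integral_times_hart_derivative; (rule ab ha hb a' b'))+
    show "(\<integral>t. (a t + b t) * (a' t + b' t) \<partial>M) = 0"
    proof (rule integral_times_hart_derivative)
      show "continuous_on UNIV (\<lambda>t. a t + b t)" by (intro continuous_on_add ab)
      show "L2 M (\<lambda>t. a' t + b' t)" by (rule L2_add[OF a' b'])
      show "hart_derivative (\<lambda>t. a t + b t) (\<lambda>t. a' t + b' t)"
        by (rule hart_derivative_add[OF ha hb L2ab(1) a' L2ab(2) b'])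
    qed (simp only: ab)
  qed
  have int: "integrable M (\<lambda>t. a t * a' t)" "integrable M (\<lambda>t. b t * b' t)"
    "integrable M (\<lambda>t. a t * b' t + b t * a' t)"
    by (rule L2_mult L2ab a' b' Bochner_Integration.integrable_add)+
  have "(\<integral>t. (a t + b t) * (a' t + b' t) \<partial>M)
      = (\<integral>t. a t * a' t + b t * b' t + (a t * b' t + b t * a' t) \<partial>M)"
    by (rule Bochner_Integration.integral_cong) (simp_all add: ring_distribs)
  also have "\<dots> = (\<integral>t. a t * a' t \<partial>M) + (\<integral>t. b t * b' t \<partial>M) + (\<integral>t. a t * b' t + b t * a' t \<partial>M)"
    using int by (simp only: Bochner_Integration.integral_add Bochner_Integration.integrable_add)
  finally have cross: "(\<integral>t. a t * b' t + b t * a' t \<partial>M) = 0"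
    by (simp only: i0 add_0_left)
  have sq: "integrable M (\<lambda>t. (b' t + 2 * \<omega> * a t)\<^sup>2)" "integrable M (\<lambda>t. (a' t)\<^sup>2)" "integrable M (\<lambda>t. (a t)\<^sup>2)"
    by (intro L2_square L2_add L2_cmult L2ab a' b')+
  have "(norm (g t))\<^sup>2 - \<omega>\<^sup>2 * (norm (u t))\<^sup>2 + \<omega>\<^sup>2 * (2 - \<alpha>) * (a t)\<^sup>2
      = (b' t + 2 * \<omega> * a t)\<^sup>2 + (a' t)\<^sup>2 - (2 + \<alpha>) * \<omega>\<^sup>2 * (a t)\<^sup>2 - 2 * \<omega> * (a t * b' t + b t * a' t)" for t
  proof -
    have gr: "rotating_component \<theta> g t = a' t - \<omega> * b t" "rotating_component (\<theta> + pi / 2) g t = b' t + \<omega> * a t"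
      by (simp_all add: a'_def b'_def)
    have "(norm (g t))\<^sup>2 = (a' t - \<omega> * b t)\<^sup>2 + (b' t + \<omega> * a t)\<^sup>2" "(norm (u t))\<^sup>2 = (a t)\<^sup>2 + (b t)\<^sup>2"
      by (simp_all only: norm_square_rotating[of _ _ \<theta>] gr a_def b_def)
    then show ?thesis by (simp add: power2_eq_square algebra_simps)
  qed
  then have "energy \<alpha> \<theta> u g = (\<integral>t. (b' t + 2 * \<omega> * a t)\<^sup>2 + (a' t)\<^sup>2 - (2 + \<alpha>) * \<omega>\<^sup>2 * (a t)\<^sup>2
      - 2 * \<omega> * (a t * b' t + b t * a' t) \<partial>M)"
    by (simp add: energy_def a_def)
  also have "\<dots> = (\<integral>t. (b' t + 2 * \<omega> * a t)\<^sup>2 \<partial>M) + (\<integral>t. (a' t)\<^sup>2 \<partial>M)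
      - (2 + \<alpha>) * \<omega>\<^sup>2 * (\<integral>t. (a t)\<^sup>2 \<partial>M) - 2 * \<omega> * (\<integral>t. a t * b' t + b t * a' t \<partial>M)"
  proof -
    have "(\<integral>t. W t + X t - c * Y t - d * Z t \<partial>M)
        = (\<integral>t. W t \<partial>M) + (\<integral>t. X t \<partial>M) - c * (\<integral>t. Y t \<partial>M) - d * (\<integral>t. Z t \<partial>M)"
      if "integrable M W" "integrable M X" "integrable M Y" "integrable M Z" for W X Y Z :: "real \<Rightarrow> real" and c d
      using that by simp
    from this[OF sq int(3)] show ?thesis .
  qed
  finally show "energy \<alpha> \<theta> u g
      = (\<integral>t. (b' t + 2 * \<omega> * a t)\<^sup>2 \<partial>M) + (\<integral>t. (a' t)\<^sup>2 \<partial>M) - (2 + \<alpha>) * \<omega>\<^sup>2 * (\<integral>t. (a t)\<^sup>2 \<partial>M)"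
    by (simp add: cross)
qed

text \<open>\<open>m = 1\<close> puts no condition on the coefficients, \<open>m = 2\<close> one on
  those of index 1 and -1. With \<open>c\<close> the mean of \<open>a\<close> and \<open>I\<close>
  the integral of \<open>(a - c)\<^sup>2\<close>, the bounds add up to \<open>\<omega>\<^sup>2 * ((2
  - \<alpha>) * (c\<^sup>2 * T) + (m\<^sup>2 - (2 + \<alpha>)) * I)\<close>, where both terms are
  nonnegative.\<close>

lemma energy_nonneg:
  assumes u: "continuous_on UNIV u" "\<And>t. u (t + T) = u t"
    and g: "\<And>i. L2 M (\<lambda>t. g t $ i)" "\<And>i. weak_derivative (\<lambda>t. u t $ i) (\<lambda>t. g t $ i)"
    and m: "0 \<le> m" "\<alpha> \<le> 2" "2 + \<alpha> \<le> (of_int m)\<^sup>2"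
    and low: "\<And>k. k \<noteq> 0 \<Longrightarrow> \<bar>k\<bar> < m \<Longrightarrow> coeff (rotating_component \<theta> u) k = 0"
  shows "0 \<le> energy \<alpha> \<theta> u g"
proof -
  define a where "a = rotating_component \<theta> u"
  define b where "b = rotating_component (\<theta> + pi / 2) u"
  define a' where "a' = (\<lambda>t. rotating_component \<theta> g t + \<omega> * b t)"
  define b' where "b' = (\<lambda>t. rotating_component (\<theta> + pi / 2) g t - \<omega> * a t)"
  note E = energy_rotating[OF u g, of \<theta>, folded a_def b_def, folded a'_def b'_def]
  have a: "continuous_on UNIV a" "\<And>t. a (t + T) = a t"
    unfolding a_def by (intro rotating_component_continuous rotating_component_periodic u)+
  have L2a: "L2 M a" by (rule L2_continuous[OF a(1)])
  define c where "c = coeff a 0 / T"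
  have cT: "coeff a 0 = c * T" using T_pos by (simp add: c_def)
  define I where "I = (\<integral>t. (a t - c)\<^sup>2 \<partial>M)"
  have L2c: "L2 M (\<lambda>t. a t - c)" by (intro L2_diff L2a L2_const)
  have ca: "coeff (\<lambda>t. a t - c) k = coeff a k - (if k = 0 then c * T else 0)" for k
    by (simp add: coeff_diff L2a L2_const coeff_const)
  have "(of_int m * \<omega>)\<^sup>2 * I \<le> (\<integral>t. (a' t)\<^sup>2 \<partial>M)"
  proof -
    \<comment> \<open>Subtracting the mean changes the coefficient of index 0 alone, and the
      derivative relation multiplies that one by 0.\<close>
    have "hart_derivative (\<lambda>t. a t - c) a'"
      using E(1) by (auto simp: hart_derivative_def ca)
    moreover have "coeff (\<lambda>t. a t - c) k = 0" if "\<bar>k\<bar> < m" for k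
      using low[of k] that by (auto simp: ca cT a_def[symmetric])
    moreover have "continuous_on UNIV (\<lambda>t. a t - c)" by (intro continuous_intros a)
    ultimately show ?thesis
      using hart_derivative_square_ge[of "\<lambda>t. a t - c" a' m 0] a(2) E(3) m(1) by (simp add: I_def)
  qed
  moreover have "(\<integral>t. (a t)\<^sup>2 \<partial>M) = I + c\<^sup>2 * T"
  proof -
    have "(\<integral>t. (a t)\<^sup>2 \<partial>M) = (\<integral>t. (a t - c)\<^sup>2 + 2 * c * (hart 0 t * (a t - c)) + c\<^sup>2 \<partial>M)"
      by (rule Bochner_Integration.integral_cong) (simp_all add: power2_eq_square algebra_simps)
    also have "\<dots> = I + 2 * c * coeff (\<lambda>t. a t - c) 0 + (\<integral>t. c\<^sup>2 \<partial>M)"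
      using L2_square[OF L2c] L2_mult[OF L2_hart L2c, of 0] by (simp add: I_def coeff_def)
    finally show ?thesis by (simp only: ca cT integral_const) simp
  qed
  moreover have "4 * \<omega>\<^sup>2 * c\<^sup>2 * T \<le> (\<integral>t. (b' t + 2 * \<omega> * a t)\<^sup>2 \<partial>M)"
  proof -
    \<comment> \<open>\<open>b'\<close> has mean zero, so only the mean of \<open>a\<close> enters;
      Bessel's inequality is then applied to the index 0 alone.\<close>
    have "coeff (\<lambda>t. b' t + 2 * \<omega> * a t) 0 = 2 * \<omega> * (c * T)"
      using E(2) by (simp add: coeff_add L2_cmult L2a E(4) coeff_cmult hart_derivative_def cT)
    then show ?thesis
      using bessel_inequality[of "{0}" "\<lambda>t. b' t + 2 * \<omega> * a t"] T_pos
      by (simp add: L2_add L2_cmult L2a E(4) power_mult_distrib) (simp add: power2_eq_square mult_ac)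
  qed
  moreover have "energy \<alpha> \<theta> u g = (\<integral>t. (b' t + 2 * \<omega> * a t)\<^sup>2 \<partial>M) + (\<integral>t. (a' t)\<^sup>2 \<partial>M)
      - (2 + \<alpha>) * \<omega>\<^sup>2 * (\<integral>t. (a t)\<^sup>2 \<partial>M)"
    unfolding a_def b_def a'_def b'_def by (rule energy_rotating(5)[OF u g])
  moreover have "0 \<le> \<omega>\<^sup>2 * ((2 - \<alpha>) * (c\<^sup>2 * T) + ((of_int m)\<^sup>2 - (2 + \<alpha>)) * I)"
    using m T_pos by (intro mult_nonneg_nonneg add_nonneg_nonneg) (auto simp: I_def)
  moreover have "4 * \<omega>\<^sup>2 * c\<^sup>2 * T + (of_int m * \<omega>)\<^sup>2 * I - (2 + \<alpha>) * \<omega>\<^sup>2 * (I + c\<^sup>2 * T)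
      = \<omega>\<^sup>2 * ((2 - \<alpha>) * (c\<^sup>2 * T) + ((of_int m)\<^sup>2 - (2 + \<alpha>)) * I)"
    by (simp add: power2_eq_square algebra_simps)
  ultimately show ?thesis by simp
qed

text \<open>Integration by parts; the boundary terms cancel because loop and test function are
  periodic.\<close>

lemma C1_loop_has_weak_derivative:
  fixes u u' :: "real \<Rightarrow> real ^ 2"
  assumes d: "\<And>t. (u has_vector_derivative u' t) (at t)" and c: "continuous_on UNIV u'"
    and per: "\<And>t. u (t + T) = u t"
  shows "continuous_on UNIV u" "square_integrable T u'" "has_weak_derivative T u u'"
proof -
  show cu: "continuous_on UNIV u"
    using d by (auto intro!: continuous_at_imp_continuous_on has_vector_derivative_continuous)
  show "square_integrable T u'"
    unfolding square_integrable_iff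
    by (intro conjI measurable_lborel_upto borel_measurable_continuous_onI L2_continuous continuous_intros c)
  show "has_weak_derivative T u u'"
    unfolding has_weak_derivative_def set_integral_lborel_upto
  proof (intro allI impI)
    fix \<phi> assume \<phi>: "periodic_test_function T \<phi>"
    note cont = test_function_continuous[OF \<phi>]
    have "(\<integral>t. \<phi> t *\<^sub>R u' t + deriv \<phi> t *\<^sub>R u t \<partial>M) = \<phi> T *\<^sub>R u T - \<phi> 0 *\<^sub>R u 0"
    proof (rule integral_lborel_upto_FTC)
      show "((\<lambda>t. \<phi> t *\<^sub>R u t) has_vector_derivative \<phi> t *\<^sub>R u' t + deriv \<phi> t *\<^sub>R u t) (at t)" for t
        using cont(3) d
        by (intro has_vector_derivative_scaleR) (simp_all add: has_real_derivative_iff_has_vector_derivative)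
    qed (use T_pos in \<open>auto intro!: continuous_intros cont c cu\<close>)
    moreover have "\<phi> T = \<phi> 0" "u T = u 0"
      using \<phi> per[of 0] by (auto simp: periodic_test_function_def dest: spec[of _ 0])
    moreover have "integrable M (\<lambda>t. \<phi> t *\<^sub>R u' t)" "integrable M (\<lambda>t. deriv \<phi> t *\<^sub>R u t)"
      by (intro integrable_continuous_lborel_upto continuous_intros cont c cu)+
    ultimately show "(\<integral>t. deriv \<phi> t *\<^sub>R u t \<partial>M) = - (\<integral>t. \<phi> t *\<^sub>R u' t \<partial>M)"
      by (simp add: eq_neg_iff_add_eq_0 add.commute)
  qed
qed

text \<open>Testing with \<open>hart k\<close> shows that both derivatives have the same
  coefficients, and the basis is complete. This identifies the arbitrary choice
  \<open>weak_deriv\<close> with the classical derivative of a smooth loop.\<close>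

lemma weak_derivative_unique:
  assumes u: "continuous_on UNIV u"
    and g: "square_integrable T g" "has_weak_derivative T u g"
    and h: "square_integrable T h" "has_weak_derivative T u h"
  shows "AE t in M. g t = h t"
proof -
  have AE_i: "AE t in M. g t $ i - h t $ i = 0" for i
  proof (rule hart_complete)
    show "L2 M (\<lambda>t. g t $ i - h t $ i)"
      by (intro L2_diff square_integrable_component g h)
    show "coeff (\<lambda>t. g t $ i - h t $ i) k = 0" for k
      using has_weak_derivative_component[OF g(2) u g(1), of i]
        has_weak_derivative_component[OF h(2) u h(1), of i] test_function_hart[of k]
      by (simp add: coeff_diff square_integrable_component g h weak_derivative_def) (simp add: coeff_def)
  qed
  from AE_i[of 1] AE_i[of 2] show ?thesis
    by eventually_elim (simp add: vec_eq_iff forall_2)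
qed

lemma weak_deriv_W12:
  assumes "u \<in> W12_loops T"
  shows "square_integrable T (weak_deriv T u)" "has_weak_derivative T u (weak_deriv T u)"
proof -
  have "\<exists>g. square_integrable T g \<and> has_weak_derivative T u g"
    using assms by (simp add: W12_loops_def)
  from someI_ex[OF this]
  show "square_integrable T (weak_deriv T u)" "has_weak_derivative T u (weak_deriv T u)"
    by (simp_all add: weak_deriv_def)
qed

lemma energy_weak_deriv_nonneg:
  assumes "u \<in> W12_loops T" "0 \<le> m" "\<alpha> \<le> 2" "2 + \<alpha> \<le> (of_int m)\<^sup>2"
    and "\<And>k. k \<noteq> 0 \<Longrightarrow> \<bar>k\<bar> < m \<Longrightarrow> coeff (rotating_component \<theta> u) k = 0"
  shows "0 \<le> energy \<alpha> \<theta> u (weak_deriv T u)"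
proof -
  have u: "continuous_on UNIV u" "\<And>t. u (t + T) = u t"
    using assms(1) by (simp_all add: W12_loops_def)
  note g = weak_deriv_W12[OF assms(1)]
  show ?thesis
    by (rule energy_nonneg[OF u square_integrable_component[OF g(1)]
          has_weak_derivative_component[OF g(2) u(1) g(1)] assms(2-5)])
qed

text \<open>Allows the chosen weak derivative to be replaced by an explicit one.\<close>

lemma energy_cong:
  assumes u: "continuous_on UNIV u" and g: "square_integrable T g" and h: "square_integrable T h"
    and "AE t in M. g t = h t"
  shows "energy \<alpha> \<theta> u g = energy \<alpha> \<theta> u h"
  unfolding energy_def
proof (rule integral_cong_AE)
  have c: "continuous_on UNIV (\<lambda>t. \<omega>\<^sup>2 * (norm (u t))\<^sup>2)"
    "continuous_on UNIV (\<lambda>t. \<omega>\<^sup>2 * (2 - \<alpha>) * (rotating_component \<theta> u t)\<^sup>2)"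
    by (intro continuous_intros u rotating_component_continuous)+
  have m: "(\<lambda>t. (norm (f t))\<^sup>2 - \<omega>\<^sup>2 * (norm (u t))\<^sup>2 + \<omega>\<^sup>2 * (2 - \<alpha>) * (rotating_component \<theta> u t)\<^sup>2)
      \<in> borel_measurable M" if "square_integrable T f" for f
  proof -
    have "f \<in> borel_measurable M" using that by (simp add: square_integrable_iff)
    then have "(\<lambda>t. (norm (f t))\<^sup>2) \<in> borel_measurable M" by measurable
    from borel_measurable_add[OF borel_measurable_diff[OF this] ] c[THEN borel_measurable_continuous_onI, THEN measurable_lborel_upto]
    show ?thesis by blast
  qed
  from m[OF g] m[OF h]
  show "(\<lambda>t. (norm (g t))\<^sup>2 - \<omega>\<^sup>2 * (norm (u t))\<^sup>2 + \<omega>\<^sup>2 * (2 - \<alpha>) * (rotating_component \<theta> u t)\<^sup>2) \<in> borel_measurable M"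
    "(\<lambda>t. (norm (h t))\<^sup>2 - \<omega>\<^sup>2 * (norm (u t))\<^sup>2 + \<omega>\<^sup>2 * (2 - \<alpha>) * (rotating_component \<theta> u t)\<^sup>2) \<in> borel_measurable M" .
  show "AE t in M. (norm (g t))\<^sup>2 - \<omega>\<^sup>2 * (norm (u t))\<^sup>2 + \<omega>\<^sup>2 * (2 - \<alpha>) * (rotating_component \<theta> u t)\<^sup>2
      = (norm (h t))\<^sup>2 - \<omega>\<^sup>2 * (norm (u t))\<^sup>2 + \<omega>\<^sup>2 * (2 - \<alpha>) * (rotating_component \<theta> u t)\<^sup>2"
    using assms(4) by eventually_elim simp
qed

section \<open>The unstable modes\<close>

definition cos_sin :: "real \<Rightarrow> real \<Rightarrow> real \<Rightarrow> real"
  where "cos_sin c d t = c * cos (\<omega> * t) + d * sin (\<omega> * t)"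

lemma cos_sin_has_derivative: "(cos_sin c d has_real_derivative \<omega> * cos_sin d (- c) t) (at t)"
  unfolding cos_sin_def[abs_def] by (auto intro!: derivative_eq_intros simp: algebra_simps)

lemma continuous_cos_sin [continuous_intros]: "continuous_on S (cos_sin c d)"
  unfolding cos_sin_def[abs_def] by (intro continuous_intros)

lemma cos_sin_periodic: "cos_sin c d (t + T) = cos_sin c d t"
  by (simp add: cos_sin_def distrib_left frequency_times_T)

lemma cos_sin_minus: "cos_sin (- c) (- d) t = - cos_sin c d t"
  by (simp add: cos_sin_def)

lemma cos_sin_squares: "(cos_sin c d t)\<^sup>2 + (cos_sin d (- c) t)\<^sup>2 = c\<^sup>2 + d\<^sup>2"
proof -
  have "(c * C + d * S)\<^sup>2 + (d * C + - c * S)\<^sup>2 = (c\<^sup>2 + d\<^sup>2) * (S\<^sup>2 + C\<^sup>2)" for C S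
    by (simp add: power2_eq_square algebra_simps)
  then show ?thesis
    by (simp only: cos_sin_def sin_cos_squared_add mult_1_right)
qed

lemma integral_cos_sin_square: "(\<integral>t. (cos_sin c d t)\<^sup>2 \<partial>M) = (c\<^sup>2 + d\<^sup>2) / 2 * T"
proof -
  \<comment> \<open>Frequency \<open>2 * \<omega>\<close> in the form to which
    \<open>integral_cos\<close> applies; the integral vanishes for either phase.\<close>
  let ?f = "\<lambda>e t. cos (of_int 2 * \<omega> * t + e)"
  have "(cos_sin c d t)\<^sup>2 = (c\<^sup>2 + d\<^sup>2) / 2 + (c\<^sup>2 - d\<^sup>2) / 2 * ?f 0 t + c * d * ?f (- (pi / 2)) t" for t
  proof -
    let ?C = "cos (\<omega> * t)" and ?S = "sin (\<omega> * t)"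
    have "?f 0 t = cos (2 * (\<omega> * t))" "?f (- (pi / 2)) t = sin (2 * (\<omega> * t))"
      by (simp_all add: sin_eq_cos_shift mult.assoc)
    then have f: "?f 0 t = ?C\<^sup>2 - ?S\<^sup>2" "?f (- (pi / 2)) t = 2 * ?S * ?C"
      by (simp_all only: cos_double sin_double)
    have "(c * C + d * S)\<^sup>2
        = (c\<^sup>2 + d\<^sup>2) / 2 * (S\<^sup>2 + C\<^sup>2) + (c\<^sup>2 - d\<^sup>2) / 2 * (C\<^sup>2 - S\<^sup>2) + c * d * (2 * S * C)" for C S
      by (simp add: power2_eq_square field_simps)
    then show ?thesis
      unfolding f by (simp only: cos_sin_def sin_cos_squared_add mult_1_right)
  qed
  then have "(\<integral>t. (cos_sin c d t)\<^sup>2 \<partial>M)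
      = (\<integral>t. (c\<^sup>2 + d\<^sup>2) / 2 + (c\<^sup>2 - d\<^sup>2) / 2 * ?f 0 t + c * d * ?f (- (pi / 2)) t \<partial>M)"
    by (simp only:)
  also have "\<dots> = (\<integral>t. (c\<^sup>2 + d\<^sup>2) / 2 \<partial>M) + (c\<^sup>2 - d\<^sup>2) / 2 * (\<integral>t. ?f 0 t \<partial>M) + c * d * (\<integral>t. ?f (- (pi / 2)) t \<partial>M)"
  proof -
    have lin: "(\<integral>t. r + x * X t + y * Y t \<partial>M) = (\<integral>t. r \<partial>M) + x * (\<integral>t. X t \<partial>M) + y * (\<integral>t. Y t \<partial>M)"
      if "integrable M X" "integrable M Y" for X Y :: "real \<Rightarrow> real" and r x y
      using that by simp
    have "integrable M (?f e)" for e
      by (intro integrable_continuous_lborel_upto continuous_intros)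
    then show ?thesis by (rule lin[OF _ ]) (rule \<open>\<And>e. integrable M (?f e)\<close>)
  qed
  finally show ?thesis unfolding integral_cos integral_const by simp
qed

text \<open>Radial component \<open>a = cos_sin c d\<close>, tangential component
  \<open>2 * cos_sin d (- c)\<close>; the derivative of the latter is
  \<open>- 2 * \<omega> * a\<close>, which makes the first square of the form vanish.\<close>

definition unstable_mode :: "real \<Rightarrow> real \<Rightarrow> real \<Rightarrow> real \<Rightarrow> real ^ 2"
  where "unstable_mode \<theta> c d t = vector
    [cos_sin c d t * cos (\<omega> * t + \<theta>) - 2 * cos_sin d (- c) t * sin (\<omega> * t + \<theta>),
     cos_sin c d t * sin (\<omega> * t + \<theta>) + 2 * cos_sin d (- c) t * cos (\<omega> * t + \<theta>)]"

text \<open>Relative to the frame this vector has radial component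
  \<open>- \<omega> * cos_sin d (- c) t\<close> and tangential component
  \<open>- \<omega> * cos_sin c d t\<close>.\<close>

definition unstable_mode_deriv :: "real \<Rightarrow> real \<Rightarrow> real \<Rightarrow> real \<Rightarrow> real ^ 2"
  where "unstable_mode_deriv \<theta> c d t = vector
    [\<omega> * (cos_sin c d t * sin (\<omega> * t + \<theta>) - cos_sin d (- c) t * cos (\<omega> * t + \<theta>)),
     - \<omega> * (cos_sin c d t * cos (\<omega> * t + \<theta>) + cos_sin d (- c) t * sin (\<omega> * t + \<theta>))]"

lemma unstable_mode_has_derivative:
  "(unstable_mode \<theta> c d has_vector_derivative unstable_mode_deriv \<theta> c d t) (at t)"
  unfolding unstable_mode_def[abs_def] unstable_mode_deriv_def
proof (rule vector_2_has_vector_derivative)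
  show "((\<lambda>t. cos_sin c d t * cos (\<omega> * t + \<theta>) - 2 * cos_sin d (- c) t * sin (\<omega> * t + \<theta>)) has_real_derivative
      \<omega> * (cos_sin c d t * sin (\<omega> * t + \<theta>) - cos_sin d (- c) t * cos (\<omega> * t + \<theta>))) (at t)"
    by (rule derivative_eq_intros cos_sin_has_derivative refl)+ (simp add: cos_sin_minus algebra_simps)
  show "((\<lambda>t. cos_sin c d t * sin (\<omega> * t + \<theta>) + 2 * cos_sin d (- c) t * cos (\<omega> * t + \<theta>)) has_real_derivative
      - \<omega> * (cos_sin c d t * cos (\<omega> * t + \<theta>) + cos_sin d (- c) t * sin (\<omega> * t + \<theta>))) (at t)"
    by (rule derivative_eq_intros cos_sin_has_derivative refl)+ (simp add: cos_sin_minus algebra_simps)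
qed

lemma unstable_mode_deriv_continuous: "continuous_on UNIV (unstable_mode_deriv \<theta> c d)"
  unfolding unstable_mode_deriv_def[abs_def] by (intro continuous_on_vector_2 continuous_intros)

lemma unstable_mode_periodic: "unstable_mode \<theta> c d (t + T) = unstable_mode \<theta> c d t"
proof -
  have "cos (\<omega> * (t + T) + \<theta>) = cos (\<omega> * t + \<theta>)" "sin (\<omega> * (t + T) + \<theta>) = sin (\<omega> * t + \<theta>)"
    using cos_periodic[of 1 t \<theta>] cos_periodic[of 1 t "\<theta> - pi / 2"]
    by (simp_all only: sin_eq_cos_shift add_diff_eq of_int_1 mult_1_left)
  then show ?thesis by (simp only: unstable_mode_def cos_sin_periodic)
qed

lemmas unstable_mode_weak_derivative = C1_loop_has_weak_derivative[OF
    unstable_mode_has_derivative unstable_mode_deriv_continuous unstable_mode_periodic]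

lemma unstable_mode_W12: "unstable_mode \<theta> c d \<in> W12_loops T"
  using unstable_mode_weak_derivative unstable_mode_periodic unfolding W12_loops_def by blast

lemma rotating_component_unstable_mode:
  "rotating_component \<theta> (unstable_mode \<theta> c d) t = cos_sin c d t"
  "rotating_component (\<theta> + pi / 2) (unstable_mode \<theta> c d) t = 2 * cos_sin d (- c) t"
proof -
  let ?C = "cos (\<omega> * t + \<theta>)" and ?S = "sin (\<omega> * t + \<theta>)"
  have eq: "C * (A * C - 2 * D * S) + S * (A * S + 2 * D * C) = A * (S\<^sup>2 + C\<^sup>2)"
    "- S * (A * C - 2 * D * S) + C * (A * S + 2 * D * C) = 2 * D * (S\<^sup>2 + C\<^sup>2)" for A C D S :: real
    by (simp_all add: power2_eq_square algebra_simps)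
  show "rotating_component \<theta> (unstable_mode \<theta> c d) t = cos_sin c d t"
    by (simp only: rotating_component_def unstable_mode_def vector_2 eq sin_cos_squared_add mult_1_right)
  have "cos (\<omega> * t + (\<theta> + pi / 2)) = - ?S" "sin (\<omega> * t + (\<theta> + pi / 2)) = ?C"
    by (simp_all add: add.assoc[symmetric] cos_add[of _ "pi / 2"] sin_add[of _ "pi / 2"])
  then show "rotating_component (\<theta> + pi / 2) (unstable_mode \<theta> c d) t = 2 * cos_sin d (- c) t"
    by (simp only: rotating_component_def unstable_mode_def vector_2 eq sin_cos_squared_add mult_1_right)
qed

text \<open>The explicit derivative takes the place of the chosen one. The squares of
  \<open>cos_sin c d\<close> and \<open>cos_sin d (- c)\<close> have a constant sum, which leaves
  only the first to integrate, with mean \<open>(c\<^sup>2 + d\<^sup>2) / 2\<close>.\<close>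

lemma energy_unstable_mode:
  "energy \<alpha> \<theta> (unstable_mode \<theta> c d) (weak_deriv T (unstable_mode \<theta> c d))
    = - ((1 + \<alpha>) * \<omega>\<^sup>2 * (c\<^sup>2 + d\<^sup>2) / 2 * T)"
proof -
  note w = weak_deriv_W12[OF unstable_mode_W12]
  note v = unstable_mode_weak_derivative
  have "energy \<alpha> \<theta> (unstable_mode \<theta> c d) (weak_deriv T (unstable_mode \<theta> c d))
      = energy \<alpha> \<theta> (unstable_mode \<theta> c d) (unstable_mode_deriv \<theta> c d)"
    by (rule energy_cong[OF v(1) w(1) v(2) weak_derivative_unique[OF v(1) w v(2,3)]])
  also have "\<dots> = (\<integral>t. \<omega>\<^sup>2 * (5 - \<alpha>) * (cos_sin c d t)\<^sup>2 - 3 * \<omega>\<^sup>2 * (c\<^sup>2 + d\<^sup>2) \<partial>M)"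
    unfolding energy_def
  proof (rule Bochner_Integration.integral_cong)
    fix t
    let ?A = "cos_sin c d t" and ?D = "cos_sin d (- c) t"
    have "(\<omega> * (A * S - D * C))\<^sup>2 + (- \<omega> * (A * C + D * S))\<^sup>2 = \<omega>\<^sup>2 * (A\<^sup>2 + D\<^sup>2) * (S\<^sup>2 + C\<^sup>2)" for A C D S
      by (simp add: power2_eq_square algebra_simps)
    then have 1: "(norm (unstable_mode_deriv \<theta> c d t))\<^sup>2 = \<omega>\<^sup>2 * (?A\<^sup>2 + ?D\<^sup>2)"
      by (simp only: norm_square_vec_2 unstable_mode_deriv_def vector_2 sin_cos_squared_add mult_1_right)
    have 2: "(norm (unstable_mode \<theta> c d t))\<^sup>2 = ?A\<^sup>2 + (2 * ?D)\<^sup>2"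
      by (simp only: norm_square_rotating[of _ _ \<theta>] rotating_component_unstable_mode)
    have 3: "c\<^sup>2 + d\<^sup>2 = ?A\<^sup>2 + ?D\<^sup>2" by (simp only: cos_sin_squares)
    show "(norm (unstable_mode_deriv \<theta> c d t))\<^sup>2 - \<omega>\<^sup>2 * (norm (unstable_mode \<theta> c d t))\<^sup>2
        + \<omega>\<^sup>2 * (2 - \<alpha>) * (rotating_component \<theta> (unstable_mode \<theta> c d) t)\<^sup>2
        = \<omega>\<^sup>2 * (5 - \<alpha>) * ?A\<^sup>2 - 3 * \<omega>\<^sup>2 * (c\<^sup>2 + d\<^sup>2)"
      unfolding 1 2 3 rotating_component_unstable_mode by (simp add: power2_eq_square algebra_simps)
  qed simp
  also have "\<dots> = \<omega>\<^sup>2 * (5 - \<alpha>) * (\<integral>t. (cos_sin c d t)\<^sup>2 \<partial>M) - (\<integral>t. 3 * \<omega>\<^sup>2 * (c\<^sup>2 + d\<^sup>2) \<partial>M)"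
  proof -
    have "integrable M (\<lambda>t. (cos_sin c d t)\<^sup>2)"
      by (intro integrable_continuous_lborel_upto continuous_intros)
    then show ?thesis by simp
  qed
  also have "\<dots> = - ((1 + \<alpha>) * \<omega>\<^sup>2 * (c\<^sup>2 + d\<^sup>2) / 2 * T)"
    unfolding integral_cos_sin_square integral_const by (simp add: field_simps)
  finally show ?thesis .
qed

end

section \<open>Dimension count\<close>

context frequency
begin

lemma rotating_component_plus: "rotating_component \<theta> (u + v) = (\<lambda>t. rotating_component \<theta> u t + rotating_component \<theta> v t)"
  by (simp add: fun_eq_iff rotating_component_def algebra_simps)

lemma rotating_component_scaleR: "rotating_component \<theta> (r *\<^sub>R u) = (\<lambda>t. r * rotating_component \<theta> u t)"
  by (simp add: fun_eq_iff rotating_component_def scaleR_fun_def algebra_simps)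

lemma L2_rotating_component_W12: "u \<in> W12_loops T \<Longrightarrow> L2 M (rotating_component \<theta> u)"
  by (intro L2_continuous rotating_component_continuous) (simp add: W12_loops_def)

text \<open>A loop in \<open>S\<close> for which the coefficients of index 1 and -1 of the radial
  component vanish has nonnegative energy, hence is 0. So the map to these two coefficients is
  injective on \<open>S\<close>, and its target is a plane.\<close>

lemma dim_negative_subspace_le_2:
  assumes S: "subspace S" "S \<subseteq> W12_loops T" and \<alpha>: "\<alpha> \<le> 2"
    and neg: "\<And>u. u \<in> S \<Longrightarrow> u \<noteq> 0 \<Longrightarrow> energy \<alpha> \<theta> u (weak_deriv T u) < 0"
  shows "dim S \<le> 2"
proof -
  define \<Phi> where "\<Phi> u = (coeff (rotating_component \<theta> u) 1, coeff (rotating_component \<theta> u) (- 1))" for u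
  have L2: "L2 M (rotating_component \<theta> u)" if "u \<in> S" for u
    using that S(2) by (intro L2_rotating_component_W12) auto
  have plus: "\<Phi> (u + v) = \<Phi> u + \<Phi> v" if "u \<in> S" "v \<in> S" for u v
    using that by (simp add: \<Phi>_def rotating_component_plus coeff_add L2)
  have scale: "\<Phi> (r *\<^sub>R u) = r *\<^sub>R \<Phi> u" for r u
    by (simp add: \<Phi>_def rotating_component_scaleR coeff_cmult)
  have kernel: "u = 0" if u: "u \<in> S" and \<Phi>: "\<Phi> u = 0" for u
  proof (rule ccontr)
    assume "u \<noteq> 0"
    have "coeff (rotating_component \<theta> u) k = 0" if "k \<noteq> 0" "\<bar>k\<bar> < 2" for k
    proof -
      have "k = 1 \<or> k = - 1" using that by arith
      then show ?thesis using \<Phi> by (auto simp: \<Phi>_def zero_prod_def)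
    qed
    then have "0 \<le> energy \<alpha> \<theta> u (weak_deriv T u)"
      using S(2) u \<alpha> by (intro energy_weak_deriv_nonneg[of u 2]) auto
    with neg[OF u \<open>u \<noteq> 0\<close>] show False by simp
  qed
  obtain B where B: "B \<subseteq> S" "independent B" "S \<subseteq> span B" "card B = dim S"
    using basis_exists by blast
  \<comment> \<open>Additivity of \<Phi> is established on \<open>S\<close>, not on all functions; a
    linear map of the whole space that agrees with it on a basis of \<open>S\<close> takes its
    place.\<close>
  obtain f where f: "linear f" "\<And>b. b \<in> B \<Longrightarrow> f b = \<Phi> b"
    using linear_independent_extend[OF B(2), of \<Phi>] by blast
  have fS: "u \<in> S \<and> f u = \<Phi> u" if "u \<in> span B" for u
    using that
  proof (rule span_induct)
    have "\<Phi> 0 = 0" using scale[of 0 0] by simp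
    then show "subspace {u. u \<in> S \<and> f u = \<Phi> u}"
      using S(1) by (auto simp: subspace_def plus scale linear_add[OF f(1)] linear_cmul[OF f(1)] linear_0[OF f(1)])
  qed (use B f in auto)
  have "inj_on f (span B)"
  proof (rule inj_onI)
    fix u v assume uv: "u \<in> span B" "v \<in> span B" "f u = f v"
    then have d: "u - v \<in> span B" by (intro span_diff)
    have "f (u - v) = 0" using uv(3) by (simp add: linear_diff[OF f(1)])
    with fS[OF d] kernel[of "u - v"] show "u = v" by simp
  qed
  then have "independent (f ` B)" "card (f ` B) = card B"
    using linear_independent_injective_image[OF f(1) B(2)] inj_on_subset[OF _ span_superset]
    by (auto intro: card_image)
  then have "card B \<le> DIM(real \<times> real)"
    using independent_bound[of "f ` B"] by simp
  with B(4) show ?thesis by simp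
qed

lemma unstable_mode_linear:
  "unstable_mode \<theta> (r * c + s * c') (r * d + s * d')
    = r *\<^sub>R unstable_mode \<theta> c d + s *\<^sub>R unstable_mode \<theta> c' d'"
  by (simp add: fun_eq_iff scaleR_fun_def vec_eq_iff forall_2 unstable_mode_def cos_sin_def algebra_simps)

lemma unstable_mode_eq_iff: "unstable_mode \<theta> c d = unstable_mode \<theta> c' d' \<longleftrightarrow> c = c' \<and> d = d'"
proof
  assume eq: "unstable_mode \<theta> c d = unstable_mode \<theta> c' d'"
  \<comment> \<open>Evaluation at time 0 recovers both parameters.\<close>
  have "c = rotating_component \<theta> (unstable_mode \<theta> c d) 0"
    "2 * d = rotating_component (\<theta> + pi / 2) (unstable_mode \<theta> c d) 0" for c d
    by (simp_all only: rotating_component_unstable_mode) (simp_all add: cos_sin_def)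
  with eq show "c = c' \<and> d = d'" by (metis mult_cancel_left zero_neq_numeral)
qed simp

lemma unstable_mode_zero: "unstable_mode \<theta> 0 0 = 0"
  using unstable_mode_linear[of \<theta> 0 0 0 0 0 0] by simp

lemma dim_span_unstable_modes:
  fixes \<theta> :: real
  defines "B \<equiv> {unstable_mode \<theta> 1 0, unstable_mode \<theta> 0 1}"
  shows "dim (span B) = 2" and "u \<in> span B \<Longrightarrow> \<exists>c d. u = unstable_mode \<theta> c d"
proof -
  have ne: "unstable_mode \<theta> 1 0 \<noteq> unstable_mode \<theta> 0 1" by (simp add: unstable_mode_eq_iff)
  have "unstable_mode \<theta> 1 0 \<notin> span {unstable_mode \<theta> 0 1}"
  proof
    assume "unstable_mode \<theta> 1 0 \<in> span {unstable_mode \<theta> 0 1}"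
    then obtain k where "unstable_mode \<theta> 1 0 = k *\<^sub>R unstable_mode \<theta> 0 1"
      by (auto simp: span_singleton)
    also have "\<dots> = unstable_mode \<theta> 0 k"
      using unstable_mode_linear[of \<theta> k 0 0 0 1 0] by simp
    finally show False by (simp add: unstable_mode_eq_iff)
  qed
  moreover have "unstable_mode \<theta> 0 1 \<noteq> 0"
    by (simp add: unstable_mode_eq_iff flip: unstable_mode_zero[of \<theta>])
  ultimately have "independent B"
    using ne by (simp add: B_def independent_insert)
  then have "dim (span B) = card B"
    by (rule dim_span_eq_card_independent)
  with ne show "dim (span B) = 2" by (simp add: B_def)
  assume "u \<in> span B"
  then obtain c d where "u - c *\<^sub>R unstable_mode \<theta> 1 0 = d *\<^sub>R unstable_mode \<theta> 0 1"
    by (auto simp: B_def span_insert span_singleton)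
  then have "u = c *\<^sub>R unstable_mode \<theta> 1 0 + d *\<^sub>R unstable_mode \<theta> 0 1"
    by (simp add: algebra_simps)
  also have "\<dots> = unstable_mode \<theta> c d"
    using unstable_mode_linear[of \<theta> c 1 d 0 0 1] by simp
  finally show "\<exists>c d. u = unstable_mode \<theta> c d" by blast
qed

end

section \<open>The two cases of the Morse index\<close>

theorem theorem4:
  fixes \<alpha> \<xi>\<^sub>0 \<theta>\<^sub>0 \<omega> :: real and p q :: "real \<Rightarrow> real" and x :: "real \<Rightarrow> real ^ 2"
  assumes "\<alpha> < 0"
    and "\<And>\<xi>. \<xi> > 0 \<Longrightarrow> p \<xi> = 1"
    and "\<And>\<xi>. \<xi> > 0 \<Longrightarrow> q \<xi> = \<xi> powr \<alpha>"
    and "circular_solution (radial_lagrangian p q) \<xi>\<^sub>0 \<theta>\<^sub>0 \<omega> x"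
  shows "morse_index (radial_lagrangian p q) (2 * pi / \<omega>) x = (if \<alpha> \<le> -1 then 0 else 2)"
proof -
  \<comment> \<open>The Euler-Lagrange equations enter through the resulting value of
    \<open>\<omega>\<^sup>2\<close>.\<close>
  have circ: "\<xi>\<^sub>0 > 0" "\<omega> > 0" "x = (\<lambda>t. polar \<xi>\<^sub>0 (\<theta>\<^sub>0 + \<omega> * t))" "\<omega>\<^sup>2 = - \<alpha> * \<xi>\<^sub>0 powr (\<alpha> - 2)"
    using circular_solution_iff[of p q \<alpha> \<xi>\<^sub>0 \<theta>\<^sub>0 \<omega> x] assms(2-4) by auto
  interpret frequency \<omega> by standard (rule circ(2))
  let ?L = "radial_lagrangian p q"
  define P where "P S \<longleftrightarrow> subspace S \<and> S \<subseteq> W12_loops T \<and> (\<exists>B. finite B \<and> span B = S) \<and>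
    (\<forall>u\<in>S. u \<noteq> 0 \<longrightarrow> second_variation ?L T x u < 0)" for S
  have sv: "second_variation ?L T x u = energy \<alpha> \<theta>\<^sub>0 u (weak_deriv T u)" for u
    by (rule second_variation_circular[OF assms(2,3) circ(1,3,4)])
  have index: "morse_index ?L (2 * pi / \<omega>) x = Sup {enat (dim S) | S. P S}"
    by (simp only: morse_index_def T_def P_def)
  show ?thesis
  proof (cases "\<alpha> \<le> -1")
    case True
    have dim: "dim S = 0" if "P S" for S
    proof -
      have "u = 0" if "u \<in> S" for u
      proof (rule ccontr)
        assume "u \<noteq> 0"
        with \<open>u \<in> S\<close> \<open>P S\<close>[unfolded P_def] have "energy \<alpha> \<theta>\<^sub>0 u (weak_deriv T u) < 0" by (simp add: sv)
        \<comment> \<open>Here \<open>m = 1\<close>: an index \<open>k\<close> with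
          \<open>\<bar>k\<bar> < 1\<close> is 0, so the condition on the coefficients is
          empty.\<close>
        moreover have "0 \<le> energy \<alpha> \<theta>\<^sub>0 u (weak_deriv T u)"
          using \<open>u \<in> S\<close> \<open>P S\<close>[unfolded P_def] True by (intro energy_weak_deriv_nonneg[of u 1]) auto
        ultimately show False by simp
      qed
      then have "S \<subseteq> span {}" by auto
      then show ?thesis using dim_le_card[of S "{}"] by simp
    qed
    have "Sup {enat (dim S) | S. P S} \<le> 0"
    proof (rule Sup_least)
      fix n assume "n \<in> {enat (dim S) | S. P S}"
      then obtain S where "n = enat (dim S)" "P S" by blast
      with dim[of S] show "n \<le> 0" by (simp add: zero_enat_def)
    qed
    with True show ?thesis by (simp add: index)
  next
    case False
    let ?S = "span {unstable_mode \<theta>\<^sub>0 1 0, unstable_mode \<theta>\<^sub>0 0 1}"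
    have "P ?S"
      unfolding P_def
    proof (intro conjI)
      show "?S \<subseteq> W12_loops T"
        using dim_span_unstable_modes(2) unstable_mode_W12 by blast
      show "\<exists>B. finite B \<and> span B = ?S" by (intro exI[of _ "{unstable_mode \<theta>\<^sub>0 1 0, unstable_mode \<theta>\<^sub>0 0 1}"]) simp
      show "\<forall>u\<in>?S. u \<noteq> 0 \<longrightarrow> second_variation ?L T x u < 0"
      proof (intro ballI impI)
        fix u assume "u \<in> ?S" "u \<noteq> 0"
        then obtain c d where u: "u = unstable_mode \<theta>\<^sub>0 c d"
          using dim_span_unstable_modes(2) by blast
        with \<open>u \<noteq> 0\<close> have "c \<noteq> 0 \<or> d \<noteq> 0" using unstable_mode_zero by auto
        then have "c\<^sup>2 + d\<^sup>2 > 0" by (simp add: sum_power2_gt_zero_iff)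
        \<comment> \<open>The case assumption \<open>\<alpha> > -1\<close> enters as positivity of
          \<open>1 + \<alpha>\<close>.\<close>
        then have "0 < (1 + \<alpha>) * \<omega>\<^sup>2 * (c\<^sup>2 + d\<^sup>2) / 2 * T"
          using False circ(2) T_pos by (intro mult_pos_pos divide_pos_pos) auto
        then show "second_variation ?L T x u < 0"
          by (simp add: sv u energy_unstable_mode)
      qed
    qed (rule subspace_span)
    then have "enat (dim ?S) \<in> {enat (dim S) | S. P S}" by blast
    then have "2 \<le> Sup {enat (dim S) | S. P S}"
      by (intro Sup_upper) (simp only: dim_span_unstable_modes(1) numeral_eq_enat)
    moreover have "Sup {enat (dim S) | S. P S} \<le> 2"
    proof (rule Sup_least)
      fix n assume "n \<in> {enat (dim S) | S. P S}"
      then obtain S where S: "n = enat (dim S)" "P S" by blast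
      then have "dim S \<le> 2"
        using assms(1) by (intro dim_negative_subspace_le_2[of S \<alpha> \<theta>\<^sub>0]) (auto simp: P_def sv)
      with S(1) show "n \<le> 2" by (simp add: numeral_eq_enat)
    qed
    ultimately show ?thesis using False by (simp add: index)
  qed
qed

end
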